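(* Let $X=(X,d,\mu)$ be a metric measure space satisfying the standing assumptions of the context (in particular $\mu$ is doubling), and assume that $X$ is complete. Let $Q>0$ and $c_Q>0$ be constants such that \[ \frac{\mu(B(y,r))}{\mu(B(x,R))}\ge c_Q\Bigl(\frac rR\Bigr)^Q\qquad\text{whenever } x\in X,\ y\in B(x,R),\ 0<r<R . \] Let $1\le q,p<\infty$, $0<s<1$ and $1\le t<\infty$ be such that either (i) $q\le p\le t$, or (ii) $sp<Q$, $q\le p^*=Qp/(Q-sp)<\infty$ and $t=p$. Assume that $\mu$ is reverse doubling, and let $E\subset X$ be a closed set with $\overline{\operatorname{co\,dim}}_A(E)<sp$. Then there are constants $C>0$ and $\lambda\ge1$ such that \[ \biggl(\frac1{\mu(B)}\int_B|u(x)|^q\,d\mu(x)\biggr)^{p/q}\le C R^{sp}\,\frac1{\mu(\lambda B)}\int_{\lambda B}\biggl(\int_{\lambda B}\frac{|u(x)-u(y)|^t}{d(x,y)^{st}\mu(B(x,d(x,y)))}\,d\mu(y)\biggr)^{p/t}d\mu(x) \] whenever $u\colon X\to\mathbb R$ is a continuous function such that $u=0$ on $E$ and $B=B(w,R)$ is a ball with $w\in E$ and $0<R<\operatorname{diam}(E)/2$.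
   Context: Standing assumptions: $X=(X,d,\mu)$ is a metric measure space with at least two points, where $\mu$ is a Borel measure supported on $X$ such that $\mu(\{x\})=0$ for all $x\in X$ and $0<\mu(B)<\infty$ for all open balls $B=B(x,r)=\{y\in X: d(x,y)<r\}$, $r>0$. Each ball has a fixed center and radius, and $\lambda B(x,r)=B(x,\lambda r)$. The measure $\mu$ is doubling: there is $c_D\ge1$ such that $\mu(B(x,2r))\le c_D\,\mu(B(x,r))$ for all $x\in X$, $r>0$. Reverse doubling: there are constants $0<\kappa<1$ and $0<c_R<1$ such that $\mu(B(x,\kappa r))\le c_R\,\mu(B(x,r))$ for every $x\in X$ and $0<r<\operatorname{diam}(X)/2$. Upper Assouad codimension: for $E\subset X$ and $r>0$ let $E_r=\{x\in X:\operatorname{dist}(x,E)<r\}$. Then $\overline{\operatorname{co\,dim}}_A(E)$ is the infimum of all $Q'\ge0$ for which there is $c>0$ such that \[ \frac{\mu(E_r\cap B(x,R))}{\mu(B(x,R))}\ge c\Bigl(\frac rR\Bigr)^{Q'} \] for every $x\in E$ and all $0<r<R<\operatorname{diam}(E)$. If $E$ consists of one point, the restriction $R<\operatorname{diam}(E)$ is removed. *)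

theory Defs
  imports "HOL-Analysis.Analysis"
begin

text \<open>
  The space \<open>X\<close> is the universe of a type of class \<open>metric_space\<close>, and \<open>\<mu>\<close> is a measure on its
  Borel sigma-algebra.
\<close>

locale metric_measure_space =
  fixes M :: "'a::metric_space measure"
  assumes sets_borel: "sets M = sets borel"
    and two_points: "\<exists>x y :: 'a. x \<noteq> y"
    and null_points: "\<And>x. emeasure M {x} = 0"
    and ball_pos: "\<And>x r. 0 < r \<Longrightarrow> 0 < emeasure M (ball x r)"
    and ball_finite: "\<And>x r. 0 < r \<Longrightarrow> emeasure M (ball x r) < \<infinity>"

definition doubling :: "'a::metric_space measure \<Rightarrow> bool" where
  "doubling M \<longleftrightarrow> (\<exists>cD\<ge>1::real. \<forall>x r. 0 < r \<longrightarrow>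
     measure M (ball x (2 * r)) \<le> cD * measure M (ball x r))"

text \<open>
  The library's real-valued \<open>diameter\<close> is only meaningful for bounded sets; here unbounded sets
  must have diameter \<open>\<infinity>\<close>.
\<close>

definition ediam :: "'a::metric_space set \<Rightarrow> ennreal" where
  "ediam S = (SUP x\<in>S. SUP y\<in>S. ennreal (dist x y))"

definition reverse_doubling :: "'a::metric_space measure \<Rightarrow> bool" where
  "reverse_doubling M \<longleftrightarrow> (\<exists>\<kappa> cR :: real. 0 < \<kappa> \<and> \<kappa> < 1 \<and> 0 < cR \<and> cR < 1 \<and>
     (\<forall>x r. 0 < r \<longrightarrow> ennreal r < ediam (UNIV :: 'a set) / 2 \<longrightarrow>
        measure M (ball x (\<kappa> * r)) \<le> cR * measure M (ball x r)))"

text \<open>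
  The guard is needed since \<open>infdist x {} = 0\<close>, whereas the distance to the empty set is
  \<open>\<infinity>\<close> mathematically.
\<close>

definition nbhd :: "'a::metric_space set \<Rightarrow> real \<Rightarrow> 'a set" where
  "nbhd E r = {x. E \<noteq> {} \<and> infdist x E < r}"

text \<open>The infimum is taken in \<open>ereal\<close>, so that it would be \<open>\<infinity>\<close> if there were no admissible
  exponent.\<close>

definition upper_assouad_codim :: "'a::metric_space measure \<Rightarrow> 'a set \<Rightarrow> ereal" where
  "upper_assouad_codim M E = Inf {ereal Q' | Q'. 0 \<le> Q' \<and>
     (\<exists>c>0. \<forall>x\<in>E. \<forall>r R. 0 < r \<longrightarrow> r < R \<longrightarrow> (\<exists>a. E = {a}) \<or> ennreal R < ediam E \<longrightarrow>
        measure M (nbhd E r \<inter> ball x R) / measure M (ball x R) \<ge> c * (r / R) powr Q')}"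

text \<open>Powers of extended nonnegative reals with \<open>\<infinity> powr a = \<infinity>\<close>; only used for exponents
  \<open>a > 0\<close>.\<close>

definition epowr :: "ennreal \<Rightarrow> real \<Rightarrow> ennreal" where
  "epowr x a = (if x = \<infinity> then \<infinity> else ennreal (enn2real x powr a))"

definition mean_nn_integral :: "'a measure \<Rightarrow> 'a set \<Rightarrow> ('a \<Rightarrow> ennreal) \<Rightarrow> ennreal" where
  "mean_nn_integral M A f = (\<integral>\<^sup>+x\<in>A. f x \<partial>M) / emeasure M A"

end

(* With f_r(x) the mean of |u(x) - u(y)| over y in B(x,r), Jensen gives f_r(x) <= C r^s G(x), where G(x)
   is the inner integral of the seminorm to the power 1/t.  So G acts as a fractional Hajlasz gradient
   of u, and t plays no further role.

   Mean over B(w,R): the codimension bound lets one pass from a ball centred in E to a ball of radius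
   2^-m times as large, again centred in E, while the mean of G^p grows by at most a factor
   L = C 2^(mQ') with Q' < sp.  Iterating and telescoping, the costs form a convergent geometric series
   once m is large, and the balls shrink to a point of E, where u vanishes by continuity.

   From the mean to the L^q norm: for x in B(w,R), telescope over the balls B(x,2R/2^k) down to a scale
   that balances the two error terms; this gives |u| <= C R^s J (1 + (G/J)^alpha), where J^p is the mean
   of G^p, and alpha = 1 - sp/Q if sp < Q.  In case q <= p no telescoping is needed and alpha = 1.
   In both cases alpha q <= p. *)

theory Submission
  imports Defs
begin

text \<open>The n-th step of the telescoping along E costs a constant times (C^(1/p) * 2^(-m(s -
  Q'/p)))^n. As C does not depend on m, the gap Q' < sp outweighs it for large m; this is why the
  radii drop by 2^-m and not by 1/2. The growth of the mean is limited by a pigeonhole argument: the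
  disjoint balls around a net of E fill a share of at least a constant times 2^(-mQ') of the larger
  ball, so G^p cannot have a much larger mean on every one of them. The exponent \<alpha> = 1 - sp/Q
  satisfies \<alpha> p^* = p, so |u|^q is controlled by 1 + (G/J)^p up to and including q = p^*,
  straight from the pointwise bound. The pigeonhole argument adds integrals over disjoint sets,
  which asks for a measurable gradient. Measurability of G is never established; a function H takes
  its place, a supremum over dyadic radii that is at most a constant multiple of G. Since J occurs
  as a divisor, it is kept as a positive number whose p-th power bounds the mean, and a small
  summand tending to 0 at the end covers a mean equal to 0.\<close>

section \<open>Powers and means with values in \<open>ennreal\<close>\<close>

lemma epowr_ennreal [simp]: "0 \<le> x \<Longrightarrow> epowr (ennreal x) a = ennreal (x powr a)"
  by (simp add: epowr_def)

lemma epowr_top [simp]: "epowr top a = top"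
  by (simp add: epowr_def)

lemma epowr_mono:
  assumes "x \<le> y" "0 \<le> a"
  shows "epowr x a \<le> epowr y a"
proof (cases y)
  case (real r)
  with assms obtain r' where "x = ennreal r'" "0 \<le> r'" "r' \<le> r"
    by (cases x) (auto simp: top_unique)
  with real assms show ?thesis
    by (auto intro!: ennreal_leI powr_mono2)
qed simp

lemma epowr_ennreal_mult:
  assumes "0 < c"
  shows "epowr (ennreal c * x) a = ennreal (c powr a) * epowr x a"
  using assms by (cases x) (auto simp: powr_mult ennreal_mult_top simp flip: ennreal_mult)

lemma epowr_epowr: "epowr (epowr x a) b = epowr x (a * b)"
  by (cases x) (auto simp: powr_powr)

lemma borel_measurable_epowr [measurable (raw)]:
  "f \<in> borel_measurable M \<Longrightarrow> (\<lambda>x. epowr (f x) a) \<in> borel_measurable M"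
proof -
  assume [measurable]: "f \<in> borel_measurable M"
  have [measurable]: "{x \<in> space M. f x = \<infinity>} \<in> sets M"
    by (auto intro!: borel_measurable_eq)
  show ?thesis unfolding epowr_def
    by (intro measurable_If) measurable
qed

lemma le_one_plus_powr:
  fixes y p :: real
  assumes "0 \<le> y" "1 \<le> p"
  shows "y \<le> 1 + y powr p"
proof (cases "y \<le> 1")
  case False
  then have "y powr 1 \<le> y powr p"
    using assms by (intro powr_mono) auto
  then show ?thesis using False by simp
qed (use assms in \<open>simp add: add_increasing2\<close>)

lemma exists_dyadic_bracket:
  fixes y :: real
  assumes "1 \<le> y"
  obtains n :: nat where "2 ^ n \<le> y" "y < 2 * 2 ^ n"
proof -
  have "\<exists>n. y < 2 ^ n" using real_arch_pow[of 2 y] by auto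
  define k where "k = (LEAST n. y < 2 ^ n)"
  have k: "y < 2 ^ k" unfolding k_def by (rule LeastI_ex) fact
  then obtain n where n: "k = Suc n" using assms by (cases k) auto
  then have "\<not> y < 2 ^ n" using not_less_Least[of n "\<lambda>n. y < 2 ^ n"] by (simp add: k_def)
  with that[of n] k n show thesis by auto
qed

lemma mean_nn_integral_mono:
  "(\<And>x. x \<in> A \<Longrightarrow> f x \<le> g x) \<Longrightarrow> mean_nn_integral M A f \<le> mean_nn_integral M A g"
  unfolding mean_nn_integral_def
  by (intro divide_right_mono_ennreal nn_integral_mono) (auto simp: indicator_def)

lemma mean_nn_integral_cmult:
  assumes "f \<in> borel_measurable M" "A \<in> sets M"
  shows "mean_nn_integral M A (\<lambda>x. c * f x) = c * mean_nn_integral M A f"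
  using assms unfolding mean_nn_integral_def
  by (simp add: nn_integral_cmult mult.assoc ennreal_times_divide)

lemma mean_nn_integral_add:
  assumes "f \<in> borel_measurable M" "g \<in> borel_measurable M" "A \<in> sets M"
  shows "mean_nn_integral M A (\<lambda>x. f x + g x) = mean_nn_integral M A f + mean_nn_integral M A g"
  using assms unfolding mean_nn_integral_def
  by (simp add: nn_integral_add distrib_right add_divide_distrib_ennreal)

lemma mean_nn_integral_const:
  assumes "A \<in> sets M" "emeasure M A \<noteq> 0" "emeasure M A \<noteq> \<infinity>"
  shows "mean_nn_integral M A (\<lambda>x. c) = c"
  using assms unfolding mean_nn_integral_def
  by (simp add: nn_integral_cmult_indicator mult_divide_eq_ennreal)

lemma mean_nn_integral_le_iff:
  assumes "emeasure M A = ennreal m" "0 < m"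
  shows "mean_nn_integral M A f \<le> c \<longleftrightarrow> (\<integral>\<^sup>+x\<in>A. f x \<partial>M) \<le> c * ennreal m"
proof
  assume "mean_nn_integral M A f \<le> c"
  then have "(\<integral>\<^sup>+x\<in>A. f x \<partial>M) / ennreal m * ennreal m \<le> c * ennreal m"
    using assms by (intro mult_right_mono) (auto simp: mean_nn_integral_def)
  then show "(\<integral>\<^sup>+x\<in>A. f x \<partial>M) \<le> c * ennreal m"
    using assms by (simp add: ennreal_divide_times mult_divide_eq_ennreal)
next
  assume "(\<integral>\<^sup>+x\<in>A. f x \<partial>M) \<le> c * ennreal m"
  then show "mean_nn_integral M A f \<le> c"
    using assms by (auto simp: mean_nn_integral_def mult.commute intro!: divide_le_posI_ennreal)
qed

text \<open>\<open>f\<close> is arbitrary because it will also be the outer integrand of the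
  seminorm, whose measurability is not established.\<close>

lemma mean_nn_integral_subset:
  assumes "A \<subseteq> B" "emeasure M A = ennreal a" "emeasure M B = ennreal b" "0 < a" "0 < b" "b \<le> c * a"
  shows "mean_nn_integral M A f \<le> ennreal c * mean_nn_integral M B f"
proof -
  have "c \<ge> 0"
    using assms(4-6) by (smt (verit) mult_nonneg_nonneg mult_nonpos_nonneg)
  have "(\<integral>\<^sup>+x\<in>A. f x \<partial>M) \<le> (\<integral>\<^sup>+x\<in>B. f x \<partial>M)"
    using assms(1) by (intro nn_integral_mono) (auto simp: indicator_def)
  also have "\<dots> \<le> mean_nn_integral M B f * ennreal b"
    using mean_nn_integral_le_iff[OF assms(3,5), of f "mean_nn_integral M B f"] by simp
  also have "\<dots> \<le> mean_nn_integral M B f * ennreal (c * a)"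
    using assms(6) by (intro mult_left_mono ennreal_leI) auto
  also have "\<dots> = ennreal c * mean_nn_integral M B f * ennreal a"
    using \<open>c \<ge> 0\<close> assms(4) by (simp add: ennreal_mult mult_ac)
  finally show ?thesis
    unfolding mean_nn_integral_le_iff[OF assms(2,4)] .
qed

text \<open>A lossy form of Jensen's inequality: the sharp constant would be 1, but the factor 2 comes
  for free from \<open>h \<le> m (1 + (h/m)\<^sup>p)\<close>.\<close>

lemma mean_nn_integral_le_of_powr:
  assumes h: "h \<in> borel_measurable M" "A \<in> sets M" "emeasure M A \<noteq> 0" "emeasure M A \<noteq> \<infinity>"
    and p: "1 \<le> p" and "0 < m"
    and le: "mean_nn_integral M A (\<lambda>x. epowr (h x) p) \<le> ennreal (m powr p)"
  shows "mean_nn_integral M A h \<le> ennreal (2 * m)"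
proof -
  have pw: "h x \<le> ennreal m + ennreal (m powr (1 - p)) * epowr (h x) p" for x
  proof (cases "h x")
    case (real y)
    have "m * (y / m) \<le> m * (1 + (y / m) powr p)"
      using le_one_plus_powr[of "y / m" p] real p \<open>0 < m\<close> by (intro mult_left_mono) auto
    then have "y \<le> m + m * (y / m) powr p"
      using \<open>0 < m\<close> by (simp add: distrib_left)
    also have "m * (y / m) powr p = m powr (1 - p) * y powr p"
      using real \<open>0 < m\<close> by (simp add: powr_divide powr_diff)
    finally show ?thesis
      using real \<open>0 < m\<close> by (simp add: ennreal_leI flip: ennreal_mult ennreal_plus)
  qed (use \<open>0 < m\<close> in \<open>auto simp: ennreal_mult_top\<close>)
  have "mean_nn_integral M A h
      \<le> mean_nn_integral M A (\<lambda>x. ennreal m + ennreal (m powr (1 - p)) * epowr (h x) p)"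
    by (intro mean_nn_integral_mono pw)
  also have "\<dots> = ennreal m + ennreal (m powr (1 - p)) * mean_nn_integral M A (\<lambda>x. epowr (h x) p)"
    using h by (simp add: mean_nn_integral_add mean_nn_integral_cmult mean_nn_integral_const)
  also have "\<dots> \<le> ennreal m + ennreal (m powr (1 - p)) * ennreal (m powr p)"
    by (intro add_left_mono mult_left_mono le) auto
  also have "\<dots> = ennreal (2 * m)"
    using \<open>0 < m\<close> by (simp flip: ennreal_mult ennreal_plus powr_add)
  finally show ?thesis .
qed

text \<open>The previous lemma divides by its bound \<open>m\<close>. The p-th root of the mean may
  be 0, so it is raised by \<open>e / 2\<close>, and \<open>e\<close> tends to 0.\<close>

lemma epowr_mean_nn_integral_le:
  assumes h: "h \<in> borel_measurable M" "A \<in> sets M" "emeasure M A \<noteq> 0" "emeasure M A \<noteq> \<infinity>"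
    and p: "1 \<le> p"
  shows "mean_nn_integral M A h \<le> 2 * epowr (mean_nn_integral M A (\<lambda>x. epowr (h x) p)) (1 / p)"
proof (cases "mean_nn_integral M A (\<lambda>x. epowr (h x) p)")
  case (real y)
  define m where "m = y powr (1 / p)"
  have y: "y = m powr p" "0 \<le> m" using real p by (auto simp: m_def powr_powr)
  have "mean_nn_integral M A h \<le> ennreal (2 * m) + ennreal e" if "0 < e" for e
  proof -
    have "mean_nn_integral M A h \<le> ennreal (2 * (m + e / 2))"
    proof (rule mean_nn_integral_le_of_powr[OF h p])
      have "m powr p \<le> (m + e / 2) powr p"
        using that y p by (intro powr_mono2) auto
      then show "mean_nn_integral M A (\<lambda>x. epowr (h x) p) \<le> ennreal ((m + e / 2) powr p)"
        using real y by (simp add: ennreal_leI)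
    qed (use that y in auto)
    also have "2 * (m + e / 2) = 2 * m + e" by simp
    finally show ?thesis using that y by simp
  qed
  then have "mean_nn_integral M A h \<le> ennreal (2 * m)"
    by (rule ennreal_le_epsilon)
  also have "ennreal (2 * m) = 2 * ennreal m"
    using y by (simp add: ennreal_mult)
  finally show ?thesis using real by (simp add: m_def)
qed simp

section \<open>Measurability from lower semicontinuity\<close>

lemma borel_measurable_lsc:
  fixes F :: "'a::metric_space \<Rightarrow> ennreal"
  assumes "\<And>X x. X \<longlonglongrightarrow> x \<Longrightarrow> F x \<le> liminf (\<lambda>n. F (X n))"
  shows "F \<in> borel_measurable borel"
proof (rule borel_measurableI_le)
  fix c
  have "closed {x. F x \<le> c}"
    unfolding closed_sequential_limits
  proof safe
    fix X x assume X: "\<forall>n. X n \<in> {x. F x \<le> c}" "X \<longlonglongrightarrow> x"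
    have "F x \<le> liminf (\<lambda>n. F (X n))" by (rule assms) fact
    also have "\<dots> \<le> liminf (\<lambda>n. c)" using X(1) by (intro Liminf_mono) auto
    finally show "F x \<le> c" by (simp add: Liminf_const)
  qed
  then show "{x \<in> space borel. F x \<le> c} \<in> sets borel" by simp
qed

text \<open>Balls are open: if \<open>X\<close> tends to x, a point of \<open>ball x r\<close> lies
  in \<open>ball (X n) r\<close> for all late n. So the integrand is lower semicontinuous in x for
  each y, and Fatou's lemma passes this on to the integral.\<close>

lemma borel_measurable_nn_integral_ball:
  fixes M :: "'a::metric_space measure" and k :: "'a \<Rightarrow> 'a \<Rightarrow> ennreal"
  assumes sets: "sets M = sets borel"
    and meas: "\<And>x. k x \<in> borel_measurable M"
    and cont: "\<And>y. continuous_on UNIV (\<lambda>x. k x y)"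
  shows "(\<lambda>x. \<integral>\<^sup>+y\<in>ball x r. k x y \<partial>M) \<in> borel_measurable M"
proof -
  have [measurable]: "ball x r \<in> sets M" for x by (simp add: sets)
  note [measurable] = meas
  have "(\<lambda>x. \<integral>\<^sup>+y\<in>ball x r. k x y \<partial>M) \<in> borel_measurable borel"
  proof (rule borel_measurable_lsc)
    fix X :: "nat \<Rightarrow> 'a" and x assume X: "X \<longlonglongrightarrow> x"
    have "k x y * indicator (ball x r) y \<le> liminf (\<lambda>n. k (X n) y * indicator (ball (X n) r) y)" for y
    proof (cases "y \<in> ball x r")
      case True
      have "(\<lambda>n. dist (X n) y) \<longlonglongrightarrow> dist x y" by (intro tendsto_intros X)
      then have "\<forall>\<^sub>F n in sequentially. dist (X n) y < r"
        using True by (auto simp: order_tendsto_iff)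
      then have ev: "\<forall>\<^sub>F n in sequentially. k (X n) y \<le> k (X n) y * indicator (ball (X n) r) y"
        by eventually_elim auto
      have "(\<lambda>n. k (X n) y) \<longlonglongrightarrow> k x y"
        using continuous_on_tendsto_compose[OF cont X] by simp
      then have "k x y = liminf (\<lambda>n. k (X n) y)" by (simp add: lim_imp_Liminf)
      also have "\<dots> \<le> liminf (\<lambda>n. k (X n) y * indicator (ball (X n) r) y)"
        by (rule Liminf_mono) fact
      finally show ?thesis using True by simp
    qed simp
    then have "(\<integral>\<^sup>+y\<in>ball x r. k x y \<partial>M)
        \<le> (\<integral>\<^sup>+y. liminf (\<lambda>n. k (X n) y * indicator (ball (X n) r) y) \<partial>M)"
      by (intro nn_integral_mono)
    also have "\<dots> \<le> liminf (\<lambda>n. \<integral>\<^sup>+y\<in>ball (X n) r. k (X n) y \<partial>M)"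
      by (rule nn_integral_liminf) measurable
    finally show "(\<integral>\<^sup>+y\<in>ball x r. k x y \<partial>M) \<le> liminf (\<lambda>n. \<integral>\<^sup>+y\<in>ball (X n) r. k (X n) y \<partial>M)" .
  qed
  then show ?thesis using measurable_cong_sets[OF sets refl] by blast
qed

subsection \<open>Mean oscillation on doubling spaces\<close>

text \<open>This is f_r(x) of the overview. The oscillation is taken about the value at the centre,
  so that u x can be compared with the mean over any ball inside \<open>ball x r\<close>.\<close>

definition mean_osc :: "'a::metric_space measure \<Rightarrow> ('a \<Rightarrow> real) \<Rightarrow> real \<Rightarrow> 'a \<Rightarrow> ennreal" where
  "mean_osc M u r x = mean_nn_integral M (ball x r) (\<lambda>y. ennreal \<bar>u x - u y\<bar>)"

locale doubling_space = metric_measure_space M for M :: "'a::metric_space measure" +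
  fixes cD :: real
  assumes cD_ge_1: "1 \<le> cD"
    and measure_double: "\<And>x r. 0 < r \<Longrightarrow> measure M (ball x (2 * r)) \<le> cD * measure M (ball x r)"
begin

lemma ball_sets [measurable, simp]: "ball x r \<in> sets M"
  by (simp add: sets_borel)

lemma emeasure_ball: "emeasure M (ball x r) = ennreal (measure M (ball x r))"
proof (cases "0 < r")
  case True
  then show ?thesis
    using ball_finite[OF True, of x] by (simp add: emeasure_eq_ennreal_measure less_top)
qed (simp add: ball_empty)

lemma measure_ball_pos: "0 < r \<Longrightarrow> 0 < measure M (ball x r)"
  using ball_pos[of r x] by (simp add: emeasure_ball)

lemma emeasure_ball_neq: "0 < r \<Longrightarrow> emeasure M (ball x r) \<noteq> 0" "emeasure M (ball x r) \<noteq> \<infinity>"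
  using measure_ball_pos[of r x] by (auto simp: emeasure_ball)

lemma measure_le_ball: "A \<subseteq> ball x r \<Longrightarrow> measure M A \<le> measure M (ball x r)"
  by (cases "A \<in> sets M")
     (auto intro!: measure_mono_fmeasurable simp: fmeasurable_def emeasure_ball measure_notin_sets)

lemma measure_double_pow:
  "0 < r \<Longrightarrow> measure M (ball x (2 ^ k * r)) \<le> cD ^ k * measure M (ball x r)"
proof (induction k)
  case (Suc k)
  have "measure M (ball x (2 * (2 ^ k * r))) \<le> cD * measure M (ball x (2 ^ k * r))"
    using Suc by (intro measure_double) auto
  also have "\<dots> \<le> cD * (cD ^ k * measure M (ball x r))"
    using Suc cD_ge_1 by (intro mult_left_mono) auto
  finally show ?case by (simp add: mult_ac)
qed simp

text \<open>A way to compare balls with different centres: the triangle inequality gives the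
  inclusion, and the exponent \<open>k\<close> is its price.\<close>

lemma measure_le_doubled:
  assumes "0 < r" "A \<subseteq> ball x (2 ^ k * r)"
  shows "measure M A \<le> cD ^ k * measure M (ball x r)"
  using measure_le_ball[OF assms(2)] measure_double_pow[OF assms(1), of x k] by linarith

lemma mean_ball_subset:
  assumes "ball x a \<subseteq> ball y b" "0 < a" "0 < b" "measure M (ball y b) \<le> c * measure M (ball x a)"
  shows "mean_nn_integral M (ball x a) f \<le> ennreal c * mean_nn_integral M (ball y b) f"
  using assms measure_ball_pos by (intro mean_nn_integral_subset[OF _ emeasure_ball emeasure_ball]) auto

lemma borel_measurable_continuous [intro]:
  fixes f :: "'a \<Rightarrow> real"
  shows "continuous_on UNIV f \<Longrightarrow> f \<in> borel_measurable M"
  using borel_measurable_continuous_onI measurable_cong_sets[OF sets_borel refl] by blast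

lemma borel_measurable_mean_osc:
  assumes u: "continuous_on UNIV u"
  shows "mean_osc M u r \<in> borel_measurable M"
proof -
  have [measurable]: "u \<in> borel_measurable M" by (rule borel_measurable_continuous) fact
  have 1: "(\<lambda>x. \<integral>\<^sup>+y\<in>ball x r. ennreal \<bar>u x - u y\<bar> \<partial>M) \<in> borel_measurable M"
    by (rule borel_measurable_nn_integral_ball[OF sets_borel]) (auto intro!: continuous_intros continuous_on_ennreal u)
  have "(\<lambda>x. \<integral>\<^sup>+y\<in>ball x r. 1 \<partial>M) \<in> borel_measurable M"
    by (rule borel_measurable_nn_integral_ball[OF sets_borel]) (auto intro: continuous_intros)
  then have "(\<lambda>x. emeasure M (ball x r)) \<in> borel_measurable M" by simp
  with 1 show ?thesis
    unfolding mean_osc_def mean_nn_integral_def by measurable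
qed

text \<open>A measurable substitute for the gradient. Joint measurability of the kernel of the seminorm is
  not available, as the library's product sigma-algebra contains the Borel sets only for types of
  class \<open>second_countable_topology\<close>; the integrals below are measurable by lower semicontinuity.\<close>

lemma fractional_sharp_function:
  assumes u: "continuous_on UNIV u" and "0 < \<rho>" "0 \<le> s"
  obtains H where "H \<in> borel_measurable M"
    and "\<And>x r. 0 < r \<Longrightarrow> r \<le> \<rho> \<Longrightarrow> mean_osc M u r x \<le> ennreal (r powr s) * H x"
    and "\<And>x G. (\<And>r. 0 < r \<Longrightarrow> r \<le> \<rho> \<Longrightarrow> mean_osc M u r x \<le> ennreal (r powr s) * G)
           \<Longrightarrow> H x \<le> ennreal (cD * 2 powr s) * G"
proof -
  \<comment> \<open>Countably many radii keep the supremum measurable. Any other r is compared with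
    the dyadic radius in [r, 2r), at the price of \<open>cD\<close> for the larger ball and 2^s for
    the larger radius. This price is put into the witness \<open>H\<close>, so that its first bound
    has no constant.\<close>
  define S where "S x = (SUP k. ennreal ((\<rho> / 2 ^ k) powr - s) * mean_osc M u (\<rho> / 2 ^ k) x)" for x
  note [measurable] = borel_measurable_mean_osc[OF u]
  have S: "S \<in> borel_measurable M" unfolding S_def by measurable
  show thesis
  proof (rule that[of "\<lambda>x. ennreal (cD * 2 powr s) * S x"])
    show "(\<lambda>x. ennreal (cD * 2 powr s) * S x) \<in> borel_measurable M"
      using S by measurable
  next
    fix x r assume r: "0 < r" "r \<le> \<rho>"
    have "\<exists>k. \<rho> / 2 ^ k < 2 * r"
      using r real_arch_pow[of 2 "\<rho> / (2 * r)"] by (auto simp: field_simps)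
    define k where "k = (LEAST k. \<rho> / 2 ^ k < 2 * r)"
    have k1: "\<rho> / 2 ^ k < 2 * r"
      unfolding k_def by (rule LeastI_ex) fact
    have k2: "r \<le> \<rho> / 2 ^ k"
    proof (cases k)
      case (Suc l)
      then have "\<not> \<rho> / 2 ^ l < 2 * r"
        using not_less_Least[of l "\<lambda>k. \<rho> / 2 ^ k < 2 * r"] by (simp add: k_def)
      then show ?thesis using Suc by (simp add: field_simps)
    qed (use r in simp)
    let ?q = "\<rho> / 2 ^ k"
    have q: "0 < ?q" using r by auto
    have "mean_osc M u ?q x = ennreal (?q powr s) * (ennreal (?q powr - s) * mean_osc M u ?q x)"
    proof -
      have "?q powr s * ?q powr - s = 1" using \<open>0 < \<rho>\<close> by (simp flip: powr_add)
      then show ?thesis by (simp add: mult.assoc[symmetric] flip: ennreal_mult)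
    qed
    also have "\<dots> \<le> ennreal (r powr s * 2 powr s) * S x"
      unfolding S_def
    proof (intro mult_mono SUP_upper ennreal_leI)
      show "?q powr s \<le> r powr s * 2 powr s"
      proof -
        have "?q powr s \<le> (r * 2) powr s"
          using k1 q \<open>0 \<le> s\<close> by (intro powr_mono2) auto
        then show ?thesis by (simp add: powr_mult)
      qed
    qed auto
    finally have "ennreal cD * mean_osc M u ?q x \<le> ennreal cD * (ennreal (r powr s * 2 powr s) * S x)"
      by (intro mult_left_mono) auto
    moreover have "mean_osc M u r x \<le> ennreal cD * mean_osc M u ?q x"
      unfolding mean_osc_def
    proof (rule mean_ball_subset)
      show "measure M (ball x ?q) \<le> cD * measure M (ball x r)"
        using measure_le_doubled[of r "ball x ?q" x 1] k1 r by (auto simp: subset_ball)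
    qed (use k2 r q in auto)
    moreover have "ennreal cD * (ennreal (r powr s * 2 powr s) * S x)
        = ennreal (r powr s) * (ennreal (cD * 2 powr s) * S x)"
      using cD_ge_1 by (simp add: ennreal_mult mult_ac)
    ultimately show "mean_osc M u r x \<le> ennreal (r powr s) * (ennreal (cD * 2 powr s) * S x)"
      by simp
  next
    fix x G assume G: "\<And>r. 0 < r \<Longrightarrow> r \<le> \<rho> \<Longrightarrow> mean_osc M u r x \<le> ennreal (r powr s) * G"
    have "S x \<le> G"
      unfolding S_def
    proof (rule SUP_least)
      fix k :: nat
      let ?q = "\<rho> / 2 ^ k"
      have q: "0 < ?q" "?q \<le> \<rho>" using \<open>0 < \<rho>\<close> by (auto simp: field_simps)
      have "ennreal (?q powr - s) * mean_osc M u ?q x \<le> ennreal (?q powr - s) * (ennreal (?q powr s) * G)"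
        using G[OF q] by (intro mult_left_mono) auto
      also have "\<dots> = G"
      proof -
        have "?q powr - s * ?q powr s = 1" using \<open>0 < \<rho>\<close> by (simp flip: powr_add)
        then show ?thesis by (simp add: mult.assoc[symmetric] flip: ennreal_mult)
      qed
      finally show "ennreal (?q powr - s) * mean_osc M u ?q x \<le> G" .
    qed
    then show "ennreal (cD * 2 powr s) * S x \<le> ennreal (cD * 2 powr s) * G"
      by (intro mult_left_mono) auto
  qed
qed

text \<open>For d(x,y) < r the denominator of the kernel is at most \<open>c\<close>, its value at
  distance r. So the mean of |u x - u y|^t over \<open>ball x r\<close> is at most r^(st) times the
  inner integral, and Jensen's inequality with exponent t, with its lossy factor 2, gives the
  claim.\<close>

lemma mean_osc_le_seminorm:
  assumes u: "continuous_on UNIV u" and "1 \<le> t" "0 < s" "0 < r" and sub: "ball x r \<subseteq> B"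
  shows "mean_osc M u r x \<le> ennreal (r powr s) *
    (2 * epowr (\<integral>\<^sup>+y\<in>B. ennreal (\<bar>u x - u y\<bar> powr t /
                      (dist x y powr (s * t) * measure M (ball x (dist x y)))) \<partial>M) (1 / t))"
    (is "_ \<le> _ * (2 * epowr ?g _)")
proof -
  have [measurable]: "u \<in> borel_measurable M" by (rule borel_measurable_continuous) fact
  define c where "c = r powr (s * t) * measure M (ball x r)"
  have "0 < c" using measure_ball_pos[OF \<open>0 < r\<close>, of x] \<open>0 < r\<close> by (simp add: c_def)
  let ?I = "\<integral>\<^sup>+y\<in>ball x r. epowr (ennreal \<bar>u x - u y\<bar>) t \<partial>M"
  have "ennreal (1 / c) * ?I = (\<integral>\<^sup>+y. ennreal (1 / c) * (epowr (ennreal \<bar>u x - u y\<bar>) t * indicator (ball x r) y) \<partial>M)"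
    by (rule nn_integral_cmult[symmetric]) measurable
  also have "\<dots> \<le> ?g"
  proof (intro nn_integral_mono)
    fix y
    show "ennreal (1 / c) * (epowr (ennreal \<bar>u x - u y\<bar>) t * indicator (ball x r) y)
      \<le> ennreal (\<bar>u x - u y\<bar> powr t / (dist x y powr (s * t) * measure M (ball x (dist x y)))) * indicator B y"
    \<comment> \<open>On the diagonal both sides are 0, since the numerator vanishes.\<close>
    proof (cases "y \<in> ball x r \<and> x \<noteq> y")
      case True
      then have "\<bar>u x - u y\<bar> powr t / c \<le>
          \<bar>u x - u y\<bar> powr t / (dist x y powr (s * t) * measure M (ball x (dist x y)))"
        unfolding c_def using assms measure_ball_pos[of "dist x y" x]
        by (intro frac_le mult_mono powr_mono2 measure_le_ball) auto
      then show ?thesis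
        using True sub \<open>0 < c\<close> by (auto simp: ennreal_leI simp flip: ennreal_mult)
    qed auto
  qed
  finally have "ennreal c * (ennreal (1 / c) * ?I) \<le> ennreal c * ?g"
    by (intro mult_left_mono) auto
  then have "?I \<le> ennreal c * ?g"
    using \<open>0 < c\<close> by (simp add: mult.assoc[symmetric] flip: ennreal_mult)
  then have "mean_nn_integral M (ball x r) (\<lambda>y. epowr (ennreal \<bar>u x - u y\<bar>) t)
      \<le> ennreal (r powr (s * t)) * ?g"
    using mean_nn_integral_le_iff[OF emeasure_ball measure_ball_pos[OF \<open>0 < r\<close>]]
    by (simp add: c_def ennreal_mult mult_ac)
  then have "epowr (mean_nn_integral M (ball x r) (\<lambda>y. epowr (ennreal \<bar>u x - u y\<bar>) t)) (1 / t)
      \<le> epowr (ennreal (r powr (s * t)) * ?g) (1 / t)"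
    using assms by (intro epowr_mono) auto
  also have "\<dots> = ennreal (r powr s) * epowr ?g (1 / t)"
    using assms by (simp add: epowr_ennreal_mult powr_powr)
  finally have 1: "epowr (mean_nn_integral M (ball x r) (\<lambda>y. epowr (ennreal \<bar>u x - u y\<bar>) t)) (1 / t)
      \<le> ennreal (r powr s) * epowr ?g (1 / t)" .
  have "mean_osc M u r x
      \<le> 2 * epowr (mean_nn_integral M (ball x r) (\<lambda>y. epowr (ennreal \<bar>u x - u y\<bar>) t)) (1 / t)"
    unfolding mean_osc_def using assms emeasure_ball_neq
    by (intro epowr_mean_nn_integral_le) auto
  also have "\<dots> \<le> 2 * (ennreal (r powr s) * epowr ?g (1 / t))"
    using 1 by (intro mult_left_mono) auto
  finally show ?thesis by (simp add: mult_ac)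
qed

text \<open>Average |u z| <= |u v| + |u z - u v| over v in \<open>ball y a\<close>. This ball has at
  least the share 1/c of the measure of \<open>ball z \<rho>\<close>, so the second mean is at most
  c times the oscillation there.\<close>

lemma abs_le_mean_plus_mean_osc:
  assumes u: "continuous_on UNIV u" and r: "0 < a" "0 < \<rho>"
    and sub: "ball y a \<subseteq> ball z \<rho>" "measure M (ball z \<rho>) \<le> c * measure M (ball y a)"
  shows "ennreal \<bar>u z\<bar> \<le> mean_nn_integral M (ball y a) (\<lambda>v. ennreal \<bar>u v\<bar>) + ennreal c * mean_osc M u \<rho> z"
proof -
  have [measurable]: "u \<in> borel_measurable M" by (rule borel_measurable_continuous) fact
  have "ennreal \<bar>u z\<bar> = mean_nn_integral M (ball y a) (\<lambda>v. ennreal \<bar>u z\<bar>)"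
    using r emeasure_ball_neq by (simp add: mean_nn_integral_const)
  also have "\<dots> \<le> mean_nn_integral M (ball y a) (\<lambda>v. ennreal \<bar>u v\<bar> + ennreal \<bar>u z - u v\<bar>)"
    by (intro mean_nn_integral_mono) (auto simp flip: ennreal_plus intro!: ennreal_leI)
  also have "\<dots> = mean_nn_integral M (ball y a) (\<lambda>v. ennreal \<bar>u v\<bar>) +
      mean_nn_integral M (ball y a) (\<lambda>v. ennreal \<bar>u z - u v\<bar>)"
    by (intro mean_nn_integral_add) auto
  also have "\<dots> \<le> mean_nn_integral M (ball y a) (\<lambda>v. ennreal \<bar>u v\<bar>) + ennreal c * mean_osc M u \<rho> z"
    unfolding mean_osc_def using sub r by (intro add_left_mono mean_ball_subset) auto
  finally show ?thesis .
qed

text \<open>The step of both telescoping sums: the previous bound, averaged over z. In one sum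
  \<open>ball y a\<close> is the smaller ball, in the other the larger one, so the two balls are
  tied to each other only through \<open>ball z \<rho>\<close>. The factor 2 is the loss in Jensen's
  inequality.\<close>

lemma mean_le_mean_plus:
  assumes u: "continuous_on UNIV u" and H: "H \<in> borel_measurable M"
    and r: "0 < a" "0 < b" "0 < \<rho>" and "1 \<le> p" "0 < m" "0 \<le> c"
    and sub: "\<And>z. z \<in> ball x b \<Longrightarrow> ball y a \<subseteq> ball z \<rho>"
      "\<And>z. z \<in> ball x b \<Longrightarrow> measure M (ball z \<rho>) \<le> c * measure M (ball y a)"
    and osc: "\<And>z. z \<in> ball x b \<Longrightarrow> mean_osc M u \<rho> z \<le> ennreal (\<rho> powr s) * H z"
    and m: "mean_nn_integral M (ball x b) (\<lambda>z. epowr (H z) p) \<le> ennreal (m powr p)"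
  shows "mean_nn_integral M (ball x b) (\<lambda>v. ennreal \<bar>u v\<bar>)
    \<le> mean_nn_integral M (ball y a) (\<lambda>v. ennreal \<bar>u v\<bar>) + ennreal (2 * c * \<rho> powr s * m)"
proof -
  let ?A = "mean_nn_integral M (ball y a) (\<lambda>v. ennreal \<bar>u v\<bar>)"
  have "mean_nn_integral M (ball x b) (\<lambda>v. ennreal \<bar>u v\<bar>)
      \<le> mean_nn_integral M (ball x b) (\<lambda>z. ?A + ennreal (c * \<rho> powr s) * H z)"
  proof (intro mean_nn_integral_mono)
    fix z assume z: "z \<in> ball x b"
    have "ennreal \<bar>u z\<bar> \<le> ?A + ennreal c * mean_osc M u \<rho> z"
      by (rule abs_le_mean_plus_mean_osc[OF u r(1,3) sub[OF z]])
    also have "\<dots> \<le> ?A + ennreal c * (ennreal (\<rho> powr s) * H z)"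
      using osc[OF z] by (intro add_left_mono mult_left_mono) auto
    finally show "ennreal \<bar>u z\<bar> \<le> ?A + ennreal (c * \<rho> powr s) * H z"
      using \<open>0 \<le> c\<close> by (simp add: ennreal_mult mult.assoc)
  qed
  also have "\<dots> = ?A + ennreal (c * \<rho> powr s) * mean_nn_integral M (ball x b) H"
    using H r emeasure_ball_neq
    by (simp add: mean_nn_integral_add mean_nn_integral_cmult mean_nn_integral_const)
  also have "\<dots> \<le> ?A + ennreal (c * \<rho> powr s) * ennreal (2 * m)"
    using r emeasure_ball_neq assms
    by (intro add_left_mono mult_left_mono mean_nn_integral_le_of_powr[where p = p]) auto
  also have "\<dots> = ?A + ennreal (2 * c * \<rho> powr s * m)"
    using assms by (simp add: mult_ac flip: ennreal_mult)
  finally show ?thesis .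
qed

subsection \<open>Balls centred in the set\<close>

text \<open>A maximal 2e-separated subset of \<open>A\<close> has both properties. It exists because
  cardinalities are bounded: the disjoint balls of radius e lie in \<open>ball x (r + e)\<close>,
  and each has at least cD^-k times the measure of \<open>ball x r\<close>.\<close>

lemma separated_net:
  fixes A :: "'a set"
  assumes "0 < e" "A \<subseteq> ball x r"
  obtains F where "finite F" "F \<subseteq> A" "disjoint_family_on (\<lambda>y. ball y e) F" "A \<subseteq> (\<Union>y\<in>F. ball y (2 * e))"
proof (cases "A = {}")
  case False
  then obtain z where "z \<in> A" by auto
  then have "dist x z < r" using assms(2) by auto
  then have "0 < r" using zero_le_dist[of x z] by linarith
  obtain k where "2 * r / e < 2 ^ k" using real_arch_pow[of 2 "2 * r / e"] by auto
  then have k: "2 * r < 2 ^ k * e" using \<open>0 < e\<close> by (simp add: field_simps)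
  define P where "P F \<longleftrightarrow> finite F \<and> F \<subseteq> A \<and> (\<forall>y\<in>F. \<forall>z\<in>F. y \<noteq> z \<longrightarrow> 2 * e \<le> dist y z)" for F
  have disj: "disjoint_family_on (\<lambda>y. ball y e) F" if "P F" for F
    using that by (auto simp: P_def disjoint_family_on_def intro!: disjoint_ballI)
  define N where "N = cD ^ k * measure M (ball x (r + e)) / measure M (ball x r)"
  have bound: "card F \<le> nat \<lceil>N\<rceil>" if F: "P F" for F
  proof -
    have "measure M (ball x r) \<le> cD ^ k * measure M (ball y e)" if "y \<in> F" for y
    proof (rule measure_le_doubled[OF \<open>0 < e\<close>])
      have "dist x y < r" using that F assms(2) by (auto simp: P_def)
      show "ball x r \<subseteq> ball y (2 ^ k * e)"
      proof
        fix z assume "z \<in> ball x r"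
        then show "z \<in> ball y (2 ^ k * e)"
          using \<open>dist x y < r\<close> k dist_triangle[of y z x] by (auto simp: dist_commute)
      qed
    qed
    then have "(\<Sum>y\<in>F. measure M (ball x r)) \<le> (\<Sum>y\<in>F. cD ^ k * measure M (ball y e))"
      by (intro sum_mono)
    also have "\<dots> = cD ^ k * measure M (\<Union>y\<in>F. ball y e)"
      using F disj[OF F] unfolding P_def
      by (subst measure_finite_Union) (auto simp: emeasure_ball sum_distrib_left)
    also have "\<dots> \<le> cD ^ k * measure M (ball x (r + e))"
    proof (intro mult_left_mono measure_le_ball subsetI)
      fix z assume "z \<in> (\<Union>y\<in>F. ball y e)"
      then obtain y where "y \<in> F" "dist y z < e" by auto
      moreover have "dist x y < r" using \<open>y \<in> F\<close> F assms(2) by (auto simp: P_def)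
      ultimately show "z \<in> ball x (r + e)" using dist_triangle[of x z y] by auto
    qed (use cD_ge_1 in auto)
    finally have "real (card F) \<le> N"
      using measure_ball_pos[OF \<open>0 < r\<close>, of x] by (simp add: N_def field_simps)
    then show ?thesis by linarith
  qed
  have "P {}" by (simp add: P_def)
  define F where "F = arg_max card P"
  have F: "P F" and max: "\<And>F'. P F' \<Longrightarrow> card F' \<le> card F"
    using arg_max_nat_lemma[of P "{}" card "Suc (nat \<lceil>N\<rceil>)"] \<open>P {}\<close> bound
    by (auto simp: F_def less_Suc_eq_le)
  have "A \<subseteq> (\<Union>y\<in>F. ball y (2 * e))"
  proof (rule ccontr)
    assume "\<not> ?thesis"
    then obtain z where "z \<in> A" "z \<notin> (\<Union>y\<in>F. ball y (2 * e))" by blast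
    then have z: "z \<in> A" "\<And>y. y \<in> F \<Longrightarrow> 2 * e \<le> dist y z" by (auto simp: not_less)
    then have "z \<notin> F" using \<open>0 < e\<close> z(2)[of z] by auto
    moreover have "P (insert z F)"
      using F z by (auto simp: P_def dist_commute[of z])
    ultimately have False using max[of "insert z F"] F by (simp add: P_def)
    then show False .
  qed
  then show thesis using that F disj by (auto simp: P_def)
qed (use that[of "{}"] in \<open>auto simp: disjoint_family_on_def\<close>)

text \<open>A point of the neighbourhood is within e of some v in E, and v is within 2e of a net
  point; so the balls of radius 4e = 2^2 e cover, which costs \<open>cD ^ 2\<close>. As v may lie
  outside \<open>ball x \<rho>\<close>, the net has to cover E in the doubled ball.\<close>

lemma sum_measure_net_ge:
  assumes "0 < e" "e \<le> \<rho>" "E \<inter> ball x (2 * \<rho>) \<subseteq> (\<Union>y\<in>F. ball y (2 * e))"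
    and F: "finite F"
  shows "measure M (nbhd E e \<inter> ball x \<rho>) \<le> cD ^ 2 * (\<Sum>y\<in>F. measure M (ball y e))"
proof -
  let ?U = "\<Union>y\<in>F. ball y (4 * e)"
  have sub: "nbhd E e \<inter> ball x \<rho> \<subseteq> ?U"
  proof
    fix z assume "z \<in> nbhd E e \<inter> ball x \<rho>"
    then have "E \<noteq> {}" "infdist z E < e" "dist x z < \<rho>" by (auto simp: nbhd_def)
    then obtain v where v: "v \<in> E" "dist z v < e"
      by (auto simp: infdist_notempty cINF_less_iff)
    then have "dist x v < 2 * \<rho>"
      using \<open>dist x z < \<rho>\<close> assms(1,2) dist_triangle[of x v z] by auto
    then obtain y where "y \<in> F" "dist y v < 2 * e" using v assms(3) by auto
    then have "dist y z < 4 * e"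
      using v assms(1) dist_triangle[of y z v] by (auto simp: dist_commute)
    then show "z \<in> ?U" using \<open>y \<in> F\<close> by auto
  qed
  have "measure M (nbhd E e \<inter> ball x \<rho>) \<le> measure M ?U"
  \<comment> \<open>In the other case the left side is 0, the value of \<open>measure\<close>
    outside \<open>sets M\<close>.\<close>
  proof (cases "nbhd E e \<inter> ball x \<rho> \<in> sets M")
    case True
    have "?U \<in> fmeasurable M"
      using F by (intro fmeasurable.finite_UN) (auto simp: fmeasurable_def emeasure_ball)
    then show ?thesis using True sub by (intro measure_mono_fmeasurable) auto
  qed (simp add: measure_notin_sets)
  also have "\<dots> \<le> (\<Sum>y\<in>F. measure M (ball y (4 * e)))"
    using F by (intro measure_UNION_le) auto
  also have "\<dots> \<le> (\<Sum>y\<in>F. cD ^ 2 * measure M (ball y e))"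
    using measure_double_pow[OF \<open>0 < e\<close>, of _ 2] by (intro sum_mono) auto
  finally show ?thesis by (simp add: sum_distrib_left)
qed

text \<open>The balls around a net of \<open>E\<close> occupy a fixed fraction of the measure of \<open>ball x r\<close>, so the mean
  over one of them is at most the mean over \<open>ball x r\<close> times twice the inverse of that fraction.\<close>

lemma exists_child_ball:
  assumes "0 < r" "3 \<le> m" "0 < c" and e: "e = r / 2 ^ m"
    and codim: "c * (e / (r / 4)) powr Q' \<le> measure M (nbhd E e \<inter> ball x (r / 4)) / measure M (ball x (r / 4))"
    and H [measurable]: "H \<in> borel_measurable M"
    and "0 < a" and a: "mean_nn_integral M (ball x r) H \<le> ennreal a"
  obtains y where "y \<in> E" "ball y e \<subseteq> ball x r"
    "mean_nn_integral M (ball y e) H \<le> ennreal (2 * cD ^ 4 / (c * (4 / 2 ^ m) powr Q') * a)"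
proof -
  define L where "L = cD ^ 4 / (c * (4 / 2 ^ m) powr Q')"
  have "L > 0" using \<open>0 < c\<close> cD_ge_1 by (auto simp: L_def)
  have "(2::real) ^ 3 \<le> 2 ^ m" using \<open>3 \<le> m\<close> by (intro power_increasing) auto
  then have e_le: "0 < e" "8 * e \<le> r" using \<open>0 < r\<close> by (auto simp: e field_simps)
  \<comment> \<open>With the codimension bound at radius r/4, the net is taken in the ball of radius
    r/2, which leaves room for its balls of radius e inside \<open>ball x r\<close>.\<close>
  obtain F where F: "finite F" "F \<subseteq> E \<inter> ball x (r / 2)" and disj: "disjoint_family_on (\<lambda>y. ball y e) F"
    and cover: "E \<inter> ball x (r / 2) \<subseteq> (\<Union>y\<in>F. ball y (2 * e))"
    using separated_net[OF \<open>0 < e\<close>, of "E \<inter> ball x (r / 2)" x "r / 2"] by auto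
  have sub: "ball y e \<subseteq> ball x r" if "y \<in> F" for y
  proof
    fix z assume "z \<in> ball y e"
    moreover have "dist x y < r / 2" using that F by auto
    ultimately show "z \<in> ball x r" using e_le dist_triangle[of x z y] by auto
  qed
  let ?S = "\<Sum>y\<in>F. measure M (ball y e)"
  have "c * (4 / 2 ^ m) powr Q' * measure M (ball x (r / 4)) \<le> measure M (nbhd E e \<inter> ball x (r / 4))"
    using codim measure_ball_pos[of "r / 4" x] \<open>0 < r\<close> by (simp add: e field_simps)
  also have "\<dots> \<le> cD ^ 2 * ?S"
    using e_le F cover by (intro sum_measure_net_ge) auto
  finally have S_ge: "cD ^ 2 * (c * (4 / 2 ^ m) powr Q' * measure M (ball x (r / 4))) \<le> cD ^ 2 * (cD ^ 2 * ?S)"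
    using cD_ge_1 by (intro mult_left_mono) auto
  have double: "measure M (ball x r) \<le> cD ^ 2 * measure M (ball x (r / 4))"
    using measure_double_pow[of "r / 4" x 2] \<open>0 < r\<close> by simp
  \<comment> \<open>Two of the four factors \<open>cD\<close> come from the net balls of radius 4e,
    two from the passage from r/4 to r.\<close>
  have "c * (4 / 2 ^ m) powr Q' * measure M (ball x r) \<le> cD ^ 4 * ?S"
  proof -
    have "c * (4 / 2 ^ m) powr Q' * measure M (ball x r)
        \<le> c * (4 / 2 ^ m) powr Q' * (cD ^ 2 * measure M (ball x (r / 4)))"
      using \<open>0 < c\<close> double by (intro mult_left_mono) auto
    also have "\<dots> = cD ^ 2 * (c * (4 / 2 ^ m) powr Q' * measure M (ball x (r / 4)))"
      by (simp only: mult_ac)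
    also have "\<dots> \<le> cD ^ 2 * (cD ^ 2 * ?S)" by (rule S_ge)
    also have "\<dots> = cD ^ 4 * ?S" by (simp flip: power_add mult.assoc)
    finally show ?thesis .
  qed
  then have S: "measure M (ball x r) \<le> L * ?S"
    using \<open>0 < c\<close> by (simp add: L_def field_simps)
  then have "0 < L * ?S" using measure_ball_pos[OF \<open>0 < r\<close>, of x] by linarith
  \<comment> \<open>With the factor 2, nonstrict inequalities suffice for the contradiction: they
    give 2X <= X for X = a * L * S, which is positive.\<close>
  have "\<exists>y\<in>F. mean_nn_integral M (ball y e) H \<le> ennreal (2 * L * a)"
  proof (rule ccontr)
    assume "\<not> ?thesis"
    then have "ennreal (2 * L * a) * ennreal (measure M (ball y e)) \<le> (\<integral>\<^sup>+z\<in>ball y e. H z \<partial>M)" if "y \<in> F" for y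
      using that mean_nn_integral_le_iff[OF emeasure_ball measure_ball_pos[OF \<open>0 < e\<close>], where f = H]
      by (meson linear)
    then have "(\<Sum>y\<in>F. ennreal (2 * L * a) * ennreal (measure M (ball y e))) \<le> (\<Sum>y\<in>F. \<integral>\<^sup>+z\<in>ball y e. H z \<partial>M)"
      by (intro sum_mono)
    \<comment> \<open>As values of one measure with density \<open>H\<close>, the integrals over the
      disjoint balls add up to the one over their union.\<close>
    also have "\<dots> = (\<Sum>y\<in>F. emeasure (density M H) (ball y e))"
      by (simp add: emeasure_density)
    also have "\<dots> = emeasure (density M H) (\<Union>y\<in>F. ball y e)"
      using F disj by (intro sum_emeasure) auto
    also have "\<dots> \<le> emeasure (density M H) (ball x r)"
      using sub by (intro emeasure_mono) auto
    also have "\<dots> = (\<integral>\<^sup>+z\<in>ball x r. H z \<partial>M)"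
      by (simp add: emeasure_density)
    also have "\<dots> \<le> ennreal a * ennreal (measure M (ball x r))"
      using a mean_nn_integral_le_iff[OF emeasure_ball measure_ball_pos[OF \<open>0 < r\<close>]] by blast
    also have "\<dots> \<le> ennreal (a * (L * ?S))"
      using S \<open>0 < a\<close> by (auto intro!: ennreal_leI mult_left_mono simp flip: ennreal_mult)
    also have "(\<Sum>y\<in>F. ennreal (2 * L * a) * ennreal (measure M (ball y e))) = ennreal (2 * (a * (L * ?S)))"
      using \<open>0 < L\<close> \<open>0 < a\<close>
      by (simp add: sum_distrib_left mult_ac sum_nonneg flip: ennreal_mult)
    finally show False
      using \<open>0 < L * ?S\<close> \<open>0 < a\<close> mult_pos_pos[OF \<open>0 < a\<close> \<open>0 < L * ?S\<close>] by (subst (asm) ennreal_le_iff) linarith+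
  qed
  then show thesis using that sub F by (auto simp: L_def)
qed

lemma exists_ball_sequence:
  assumes "w \<in> E" "0 < R" "3 \<le> m" "0 < c" "0 < a"
    and codim: "\<And>x r \<rho>. x \<in> E \<Longrightarrow> 0 < r \<Longrightarrow> r < \<rho> \<Longrightarrow> \<rho> \<le> R \<Longrightarrow>
      c * (r / \<rho>) powr Q' \<le> measure M (nbhd E r \<inter> ball x \<rho>) / measure M (ball x \<rho>)"
    and H: "H \<in> borel_measurable M"
    and a: "mean_nn_integral M (ball w R) H \<le> ennreal a"
    and L: "L = 2 * cD ^ 4 / (c * (4 / 2 ^ m) powr Q')"
  obtains x where "x 0 = w" "\<And>n. x n \<in> E"
    "\<And>n. ball (x (Suc n)) (R / (2 ^ m) ^ Suc n) \<subseteq> ball (x n) (R / (2 ^ m) ^ n)"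
    "\<And>n. mean_nn_integral M (ball (x n) (R / (2 ^ m) ^ n)) H \<le> ennreal (L ^ n * a)"
proof -
  define r where "r n = R / (2 ^ m) ^ n" for n
  have L_pos: "0 < L" using \<open>0 < c\<close> cD_ge_1 by (auto simp: L)
  \<comment> \<open>The clause for n = 0 pins the start to w, as dependent choice leaves the first
    term open.\<close>
  define P where "P n y \<longleftrightarrow> y \<in> E \<and> (n = 0 \<longrightarrow> y = w) \<and>
    mean_nn_integral M (ball y (r n)) H \<le> ennreal (L ^ n * a)" for n :: nat and y
  have "\<exists>x. \<forall>n. P n (x n) \<and> ball (x (Suc n)) (r (Suc n)) \<subseteq> ball (x n) (r n)"
  proof (rule dependent_nat_choice)
    show "\<exists>x. P 0 x" using assms by (auto simp: P_def r_def)
  next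
    fix x n assume P: "P n x"
    have r: "0 < r n" "r n \<le> R"
      using \<open>0 < R\<close> by (auto simp: r_def divide_le_eq mult_le_cancel_left1 one_le_power)
    have "(2::real) ^ 3 \<le> 2 ^ m" using \<open>3 \<le> m\<close> by (intro power_increasing) auto
    then have "r (Suc n) < r n / 4" using r by (auto simp: r_def divide_simps)
    have a': "0 < L ^ n * a" using L_pos \<open>0 < a\<close> by simp
    have Suc: "r (Suc n) = r n / 2 ^ m" by (simp add: r_def)
    obtain y where y: "y \<in> E" "ball y (r (Suc n)) \<subseteq> ball x (r n)"
      "mean_nn_integral M (ball y (r (Suc n))) H \<le> ennreal (2 * cD ^ 4 / (c * (4 / 2 ^ m) powr Q') * (L ^ n * a))"
    proof (rule exists_child_ball[OF r(1) \<open>3 \<le> m\<close> \<open>0 < c\<close> Suc _ H a'])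
      show "c * (r (Suc n) / (r n / 4)) powr Q'
          \<le> measure M (nbhd E (r (Suc n)) \<inter> ball x (r n / 4)) / measure M (ball x (r n / 4))"
        using P r \<open>r (Suc n) < r n / 4\<close> \<open>0 < R\<close> by (intro codim) (auto simp: P_def r_def)
    qed (use P in \<open>auto simp: P_def\<close>)
    then have "P (Suc n) y" by (simp add: P_def L mult_ac)
    with y show "\<exists>y. P (Suc n) y \<and> ball y (r (Suc n)) \<subseteq> ball x (r n)" by blast
  qed
  then show thesis using that unfolding P_def r_def by blast
qed

section \<open>Telescoping down to a point of E\<close>

text \<open>Each ball contains its centre, so by nesting alone all later centres are within
  \<open>r n\<close> of \<open>x n\<close>.\<close>

lemma nested_balls_converge:
  fixes x :: "nat \<Rightarrow> 'a"
  assumes "complete (UNIV :: 'a set)" "\<And>n. 0 < r n" "r \<longlonglongrightarrow> 0"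
    and nest: "\<And>n. ball (x (Suc n)) (r (Suc n)) \<subseteq> ball (x n) (r n)"
  obtains l where "x \<longlonglongrightarrow> l" "\<And>n. dist (x n) l \<le> r n"
proof -
  have "ball (x k) (r k) \<subseteq> ball (x n) (r n)" if "n \<le> k" for n k
    using that by (induction rule: dec_induct) (use nest in blast)+
  then have near: "dist (x n) (x k) < r n" if "n \<le> k" for n k
    using that assms(2)[of k] centre_in_ball by (metis mem_ball subsetD)
  have "Cauchy x"
  proof (rule metric_CauchyI)
    fix e :: real assume "0 < e"
    then obtain N where "r N < e / 2"
      using \<open>r \<longlonglongrightarrow> 0\<close> half_gt_zero order_tendstoD(2) eventually_happens'[OF sequentially_bot] by metis
    then have "dist (x m) (x n) < e" if "N \<le> m" "N \<le> n" for m n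
      using near[OF that(1)] near[OF that(2)] dist_triangle3[of "x m" "x n" "x N"] by linarith
    then show "\<exists>N. \<forall>m\<ge>N. \<forall>n\<ge>N. dist (x m) (x n) < e" by blast
  qed
  then obtain l where l: "x \<longlonglongrightarrow> l"
    using assms(1) completeE[of UNIV x] by auto
  have "dist (x n) l \<le> r n" for n
  proof (rule tendsto_upperbound)
    show "(\<lambda>k. dist (x n) (x k)) \<longlonglongrightarrow> dist (x n) l" by (intro tendsto_intros l)
    show "\<forall>\<^sub>F k in sequentially. dist (x n) (x k) \<le> r n"
      using eventually_ge_at_top[of n] by eventually_elim (use near in \<open>auto intro: less_imp_le\<close>)
  qed simp
  with l show thesis by (rule that)
qed

text \<open>Continuity stands in for Lebesgue points: the n-th ball lies within 2 * r n of l, where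
  |u| < e once n is large.\<close>

lemma mean_shrinking_balls_small:
  fixes u :: "'a \<Rightarrow> real"
  assumes u: "continuous_on UNIV u" and "u l = 0" "0 < e"
    and "\<And>n. 0 < r n" "r \<longlonglongrightarrow> 0" "\<And>n. dist (x n) l \<le> r n"
  obtains n where "mean_nn_integral M (ball (x n) (r n)) (\<lambda>v. ennreal \<bar>u v\<bar>) \<le> ennreal e"
proof -
  have "isCont u l" using u by (simp add: continuous_on_eq_continuous_at)
  then obtain d where d: "0 < d" "\<And>v. dist v l < d \<Longrightarrow> dist (u v) (u l) < e"
    using \<open>0 < e\<close> unfolding continuous_at_eps_delta by blast
  then obtain n where n: "r n < d / 2"
    using \<open>r \<longlonglongrightarrow> 0\<close> half_gt_zero order_tendstoD(2) eventually_happens'[OF sequentially_bot] by metis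
  have "mean_nn_integral M (ball (x n) (r n)) (\<lambda>v. ennreal \<bar>u v\<bar>)
      \<le> mean_nn_integral M (ball (x n) (r n)) (\<lambda>v. ennreal e)"
  proof (intro mean_nn_integral_mono ennreal_leI)
    fix v assume "v \<in> ball (x n) (r n)"
    then have "dist v l < d"
      using n assms(6)[of n] dist_triangle[of v l "x n"] by (auto simp: dist_commute)
    then show "\<bar>u v\<bar> \<le> e" using d(2)[of v] \<open>u l = 0\<close> by (simp add: dist_real_def)
  qed
  also have "\<dots> = ennreal e"
    using assms(4) emeasure_ball_neq by (simp add: mean_nn_integral_const)
  finally show thesis by (rule that)
qed

text \<open>Telescoping along the sequence of balls: the \<open>n\<close>-th step costs a multiple of
  \<open>(R / 2\<^sup>m\<^sup>n)\<^sup>s (L\<^sup>n)\<^sup>1\<^sup>/\<^sup>p\<close>, a geometric sequence by the choice of \<open>m\<close>.\<close>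

lemma mean_le_of_vanishing:
  fixes u :: "'a \<Rightarrow> real"
  assumes complete: "complete (UNIV :: 'a set)" and "closed E"
    and u: "continuous_on UNIV u" "\<And>x. x \<in> E \<Longrightarrow> u x = 0"
    and "w \<in> E" "0 < R" "3 \<le> m" "0 < c" "0 < s" "1 \<le> p" "0 < j"
    and codim: "\<And>x r \<rho>. x \<in> E \<Longrightarrow> 0 < r \<Longrightarrow> r < \<rho> \<Longrightarrow> \<rho> \<le> R \<Longrightarrow>
      c * (r / \<rho>) powr Q' \<le> measure M (nbhd E r \<inter> ball x \<rho>) / measure M (ball x \<rho>)"
    and H [measurable]: "H \<in> borel_measurable M"
    and osc: "\<And>z r. z \<in> ball w R \<Longrightarrow> 0 < r \<Longrightarrow> r \<le> 2 * R \<Longrightarrow> mean_osc M u r z \<le> ennreal (r powr s) * H z"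
    and j: "mean_nn_integral M (ball w R) (\<lambda>z. epowr (H z) p) \<le> ennreal (j powr p)"
    and L: "L = 2 * cD ^ 4 / (c * (4 / 2 ^ m) powr Q')"
    and contr: "(1 / 2 ^ m) powr s * L powr (1 / p) \<le> 1 / 2"
  shows "mean_nn_integral M (ball w R) (\<lambda>v. ennreal \<bar>u v\<bar>)
    \<le> ennreal (4 * cD ^ (m + 2) * 2 powr s * R powr s * j)"
proof -
  define r where "r n = R / (2 ^ m) ^ n" for n
  have L_pos: "0 < L" using \<open>0 < c\<close> cD_ge_1 by (auto simp: L)
  have jp: "0 < j powr p" using \<open>0 < j\<close> by simp
  obtain x where x0: "x 0 = w" and xE: "\<And>n. x n \<in> E"
    and nest: "\<And>n. ball (x (Suc n)) (r (Suc n)) \<subseteq> ball (x n) (r n)"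
    and mean: "\<And>n. mean_nn_integral M (ball (x n) (r n)) (\<lambda>z. epowr (H z) p) \<le> ennreal (L ^ n * j powr p)"
    unfolding r_def
  proof (rule exists_ball_sequence[OF \<open>w \<in> E\<close> \<open>0 < R\<close> \<open>3 \<le> m\<close> \<open>0 < c\<close> jp _ _ j L])
    show "c * (r / \<rho>) powr Q' \<le> measure M (nbhd E r \<inter> ball x \<rho>) / measure M (ball x \<rho>)"
      if "x \<in> E" "0 < r" "r < \<rho>" "\<rho> \<le> R" for x r \<rho> using that by (rule codim)
    show "(\<lambda>z. epowr (H z) p) \<in> borel_measurable M" by measurable
  qed blast
  have r: "0 < r n" "r n \<le> R" for n
    using \<open>0 < R\<close> by (auto simp: r_def divide_le_eq mult_le_cancel_left1 one_le_power)
  have in_w: "ball (x n) (r n) \<subseteq> ball w R" for n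
  proof (induction n)
    case (Suc n)
    then show ?case using nest[of n] by blast
  qed (simp add: x0 r_def)
  \<comment> \<open>\<open>D\<close> bounds the cost of the step at n = 0; by \<open>contr\<close>
    the bound halves with each further step.\<close>
  define D where "D = 2 * cD ^ (m + 2) * 2 powr s * R powr s * j"
  have "0 \<le> D" using cD_ge_1 \<open>0 < j\<close> by (simp add: D_def)
  let ?a = "\<lambda>n. mean_nn_integral M (ball (x n) (r n)) (\<lambda>v. ennreal \<bar>u v\<bar>)"
  have step: "?a n \<le> ?a (Suc n) + ennreal (D / 2 ^ n)" for n
  proof -
    \<comment> \<open>The p-th root of the bound L^n j^p for the mean of H^p over the n-th
      ball.\<close>
    define k where "k = (L powr (1 / p)) ^ n * j"
    have k: "0 < k" using L_pos \<open>0 < j\<close> by (simp add: k_def)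
    have "((L powr (1 / p)) ^ n) powr p = L ^ n"
      using L_pos \<open>1 \<le> p\<close> by (simp add: powr_powr powr_realpow[symmetric])
    then have kp: "k powr p = L ^ n * j powr p" by (simp add: k_def powr_mult)
    have le: "?a n \<le> ?a (Suc n) + ennreal (2 * cD ^ (m + 2) * (2 * r n) powr s * k)"
    proof (rule mean_le_mean_plus[OF u(1) H r(1) r(1) _ \<open>1 \<le> p\<close> k])
      fix z assume z: "z \<in> ball (x n) (r n)"
      show "ball (x (Suc n)) (r (Suc n)) \<subseteq> ball z (2 * r n)"
      proof
        fix v assume "v \<in> ball (x (Suc n)) (r (Suc n))"
        then have "v \<in> ball (x n) (r n)" using nest by blast
        then show "v \<in> ball z (2 * r n)"
          using z dist_triangle[of z v "x n"] by (auto simp: dist_commute)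
      qed
      show "measure M (ball z (2 * r n)) \<le> cD ^ (m + 2) * measure M (ball (x (Suc n)) (r (Suc n)))"
      proof (rule measure_le_doubled[OF r(1)])
        \<comment> \<open>Both z and the radius of its ball contribute 2 * r n as seen from the next
          centre; 4 * r n is m + 2 doublings of the next radius.\<close>
        have eq: "2 ^ (m + 2) * r (Suc n) = 4 * r n" by (simp add: r_def power_add)
        have "x (Suc n) \<in> ball (x n) (r n)" using nest r(1) centre_in_ball by blast
        then have "dist z (x (Suc n)) < 2 * r n"
          using z dist_triangle[of z "x (Suc n)" "x n"] by (auto simp: dist_commute)
        then show "ball z (2 * r n) \<subseteq> ball (x (Suc n)) (2 ^ (m + 2) * r (Suc n))"
          unfolding eq
        proof safe
          fix v assume "v \<in> ball z (2 * r n)"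
          then show "v \<in> ball (x (Suc n)) (4 * r n)"
            using \<open>dist z (x (Suc n)) < 2 * r n\<close> dist_triangle[of "x (Suc n)" v z]
            by (simp add: dist_commute)
        qed
      qed
      show "mean_osc M u (2 * r n) z \<le> ennreal ((2 * r n) powr s) * H z"
        using z in_w[of n] r[of n] by (intro osc) auto
    qed (use r[of n] cD_ge_1 mean[of n] kp in auto)
    have "2 * cD ^ (m + 2) * (2 * r n) powr s * k
        = D * ((1 / 2 ^ m) powr s * L powr (1 / p)) ^ n"
    proof -
      have "((2 ^ m) ^ n) powr s = ((2 ^ m) powr s :: real) ^ n"
        by (induction n) (auto simp: powr_mult)
      then have "r n powr s = R powr s * ((1 / 2 ^ m) powr s) ^ n"
        by (simp add: r_def divide_inverse powr_mult inverse_powr power_inverse)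
      then show ?thesis by (simp add: D_def k_def powr_mult power_mult_distrib mult_ac)
    qed
    also have "\<dots> \<le> D * (1 / 2) ^ n"
      using contr \<open>0 \<le> D\<close> by (intro mult_left_mono power_mono) auto
    finally have "2 * cD ^ (m + 2) * (2 * r n) powr s * k \<le> D / 2 ^ n"
      by (simp add: power_one_over)
    with le show ?thesis
      by (meson add_left_mono ennreal_leI order_trans)
  qed
  \<comment> \<open>\<open>D * (2 - 2 / 2 ^ n)\<close> is the sum of \<open>D / 2 ^ i\<close> over i
    < n.\<close>
  have tele: "?a 0 \<le> ?a n + ennreal (D * (2 - 2 / 2 ^ n))" for n
  proof (induction n)
    case (Suc n)
    have "0 \<le> D * (2 - 2 / 2 ^ n)"
      using \<open>0 \<le> D\<close> by (intro mult_nonneg_nonneg) (auto simp: divide_le_eq)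
    then have eq: "ennreal (D / 2 ^ n) + ennreal (D * (2 - 2 / 2 ^ n)) = ennreal (D * (2 - 2 / 2 ^ Suc n))"
      using \<open>0 \<le> D\<close> by (subst ennreal_plus[symmetric]) (auto simp: field_simps)
    have "?a 0 \<le> ?a (Suc n) + ennreal (D / 2 ^ n) + ennreal (D * (2 - 2 / 2 ^ n))"
      using Suc step[of n] by (meson add_right_mono order_trans)
    then show ?case unfolding add.assoc eq .
  qed simp
  have lim: "r \<longlonglongrightarrow> 0"
  proof -
    have "1 < (2::real) ^ m" using \<open>3 \<le> m\<close> by (intro one_less_power) auto
    then have "(\<lambda>n. R * (1 / 2 ^ m) ^ n) \<longlonglongrightarrow> R * 0"
      by (intro tendsto_mult tendsto_const LIMSEQ_realpow_zero) auto
    then show ?thesis by (simp add: r_def[abs_def] divide_inverse power_inverse)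
  qed
  obtain l where l: "x \<longlonglongrightarrow> l" "\<And>n. dist (x n) l \<le> r n"
    using nested_balls_converge[OF complete r(1) lim nest] by blast
  have "l \<in> E" using \<open>closed E\<close> l(1) xE by (meson closed_sequentially)
  then have ul: "u l = 0" by (rule u(2))
  have "?a 0 \<le> ennreal (2 * D) + ennreal e" if e: "0 < e" for e
  proof -
    obtain n where n: "?a n \<le> ennreal e"
      using mean_shrinking_balls_small[OF u(1) ul e r(1) lim l(2)] by blast
    have "?a 0 \<le> ?a n + ennreal (D * (2 - 2 / 2 ^ n))" by (rule tele)
    also have "\<dots> \<le> ennreal e + ennreal (2 * D)"
      using \<open>0 \<le> D\<close> by (intro add_mono n ennreal_leI) (auto simp: algebra_simps)
    finally show ?thesis by (simp add: add.commute)
  qed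
  then have "?a 0 \<le> ennreal (2 * D)" by (rule ennreal_le_epsilon)
  then show ?thesis by (simp add: x0 r_def D_def mult_ac)
qed

text \<open>\<open>A\<close> collects everything that does not depend on m. What remains is
  2^(-\<delta> m), where \<delta> = s - Q'/p is positive because Q' < s * p; so a large m makes the
  product small.\<close>

lemma exists_contraction_scale:
  assumes "0 < c" "Q' < s * p" "1 \<le> p"
  obtains m where "3 \<le> m" "(1 / 2 ^ m) powr s * (2 * cD ^ 4 / (c * (4 / 2 ^ m) powr Q')) powr (1 / p) \<le> 1 / 2"
proof -
  define \<delta> where "\<delta> = s - Q' / p"
  define B where "B = 2 * cD ^ 4 / (c * 4 powr Q')"
  define A where "A = B powr (1 / p)"
  have "0 < \<delta>" using assms by (simp add: \<delta>_def field_simps)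
  have eq: "(1 / 2 ^ m) powr s * (2 * cD ^ 4 / (c * (4 / 2 ^ m) powr Q')) powr (1 / p)
      = A * (2 powr - \<delta>) ^ m" for m :: nat
  proof -
    have "(2 * cD ^ 4 / (c * (4 / 2 ^ m) powr Q')) = B * (2 ^ m) powr Q'"
      by (simp add: B_def powr_divide)
    then have "(2 * cD ^ 4 / (c * (4 / 2 ^ m) powr Q')) powr (1 / p) = A * (2 ^ m) powr (Q' / p)"
      by (simp add: A_def powr_mult powr_powr)
    moreover have "(1 / 2 ^ m) powr s = (2 ^ m) powr - s"
      by (simp add: powr_divide powr_minus_divide)
    moreover have "(2 ^ m) powr - s * (2 ^ m) powr (Q' / p) = (2 powr - \<delta>) ^ m"
      by (simp add: \<delta>_def powr_power powr_realpow[symmetric] powr_powr algebra_simps flip: powr_add)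
    ultimately show ?thesis by (simp add: mult_ac)
  qed
  have "(\<lambda>m. A * (2 powr - \<delta>) ^ m) \<longlonglongrightarrow> A * 0"
    using \<open>0 < \<delta>\<close> by (intro tendsto_mult tendsto_const LIMSEQ_realpow_zero)
      (auto simp: powr_minus field_simps)
  then have "\<forall>\<^sub>F m in sequentially. A * (2 powr - \<delta>) ^ m < 1 / 2"
    by (intro order_tendstoD) auto
  then have "\<forall>\<^sub>F m in sequentially. 3 \<le> m \<and> A * (2 powr - \<delta>) ^ m < 1 / 2"
    by (intro eventually_conj eventually_ge_at_top)
  then obtain m where "3 \<le> m" "A * (2 powr - \<delta>) ^ m < 1 / 2"
    by (auto dest: eventually_happens)
  then show thesis using that[of m] unfolding eq by auto
qed

subsection \<open>Pointwise bounds\<close>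

text \<open>Serves the case q <= p: a single comparison of x with \<open>ball w R\<close>. Here
  \<open>ball x (2 * R)\<close> lies in \<open>ball w (4 * R)\<close>, hence
  \<open>cD ^ 2\<close>.\<close>

lemma abs_le_of_mean:
  assumes u: "continuous_on UNIV u" and "0 < R" "0 < j" "0 \<le> A" "x \<in> ball w R"
    and osc: "mean_osc M u (2 * R) x \<le> ennreal ((2 * R) powr s) * ennreal h" and "0 \<le> h"
    and A: "mean_nn_integral M (ball w R) (\<lambda>v. ennreal \<bar>u v\<bar>) \<le> ennreal (A * R powr s * j)"
  shows "\<bar>u x\<bar> \<le> (A + cD ^ 2 * 2 powr s) * R powr s * j * (1 + h / j)"
proof -
  have "ennreal \<bar>u x\<bar> \<le> mean_nn_integral M (ball w R) (\<lambda>v. ennreal \<bar>u v\<bar>) + ennreal (cD ^ 2) * mean_osc M u (2 * R) x"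
  proof (rule abs_le_mean_plus_mean_osc[OF u \<open>0 < R\<close>])
    have x: "dist w x < R" using assms by simp
    show "ball w R \<subseteq> ball x (2 * R)"
    proof
      fix v assume "v \<in> ball w R"
      then show "v \<in> ball x (2 * R)" using x dist_triangle[of x v w] by (simp add: dist_commute)
    qed
    show "measure M (ball x (2 * R)) \<le> cD ^ 2 * measure M (ball w R)"
    proof (rule measure_le_doubled[OF \<open>0 < R\<close>], rule)
      fix v assume "v \<in> ball x (2 * R)"
      then show "v \<in> ball w (2 ^ 2 * R)" using x \<open>0 < R\<close> dist_triangle[of w v x] by simp
    qed
  qed (use \<open>0 < R\<close> in simp)
  also have "\<dots> \<le> ennreal (A * R powr s * j) + ennreal (cD ^ 2) * (ennreal ((2 * R) powr s) * ennreal h)"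
    using A osc by (intro add_mono mult_left_mono) auto
  also have "\<dots> = ennreal (A * R powr s * j + cD ^ 2 * 2 powr s * R powr s * h)"
    using \<open>0 \<le> h\<close> \<open>0 < j\<close> \<open>0 \<le> A\<close> by (simp add: powr_mult mult_ac flip: ennreal_mult)
  finally have "\<bar>u x\<bar> \<le> A * R powr s * j + cD ^ 2 * 2 powr s * R powr s * h"
    using \<open>0 \<le> h\<close> \<open>0 < j\<close> \<open>0 \<le> A\<close> by (subst (asm) ennreal_le_iff) auto
  also have "\<dots> \<le> (A + cD ^ 2 * 2 powr s) * R powr s * j * (1 + h / j)"
    using \<open>0 < j\<close> \<open>0 \<le> h\<close> \<open>0 \<le> A\<close> by (simp add: field_simps)
  finally show ?thesis .
qed

text \<open>Since \<open>\<mu>(B(x,\<rho>)) \<ge> c (\<rho>/R)\<^sup>Q \<mu>(B(w,4R))\<close> and \<open>s < Q / p\<close>, the telescoping sum over the balls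
  \<open>B(x, 2R/2\<^sup>k)\<close> is dominated by its last term.\<close>

lemma mean_small_ball_le:
  assumes u: "continuous_on UNIV u" and H [measurable]: "H \<in> borel_measurable M"
    and "0 < R" "0 < j" "0 \<le> A" "x \<in> ball w R" "0 < s" "1 \<le> p" "0 < cQ" "s * p < Q"
    and osc: "\<And>z r. z \<in> ball w (4 * R) \<Longrightarrow> 0 < r \<Longrightarrow> r \<le> 4 * R \<Longrightarrow> mean_osc M u r z \<le> ennreal (r powr s) * H z"
    and j: "mean_nn_integral M (ball w (4 * R)) (\<lambda>z. epowr (H z) p) \<le> ennreal (j powr p)"
    and A: "mean_nn_integral M (ball w R) (\<lambda>v. ennreal \<bar>u v\<bar>) \<le> ennreal (A * R powr s * j)"
    and lower: "\<And>r. 0 < r \<Longrightarrow> r < 4 * R \<Longrightarrow>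
      cQ * (r / (4 * R)) powr Q \<le> measure M (ball x r) / measure M (ball w (4 * R))"
    and b: "b = 2 powr (Q / p - s)"
    and T: "T = 2 * cD ^ 3 * 4 powr s * (2 powr Q / cQ) powr (1 / p) * 2 powr (Q / p)"
  shows "mean_nn_integral M (ball x (2 * R / 2 ^ n)) (\<lambda>v. ennreal \<bar>u v\<bar>)
    \<le> ennreal ((A + T + T / (b - 1)) * R powr s * j * b ^ n)"
proof -
  define K where "K = (2 powr Q / cQ) powr (1 / p)"
  define r where "r n = 2 * R / 2 ^ n" for n :: nat
  have r: "0 < r n" "r n \<le> 2 * R" for n
    using \<open>0 < R\<close> by (auto simp: r_def divide_le_eq mult_le_cancel_left1)
  have K: "0 < K" using \<open>0 < cQ\<close> by (simp add: K_def)
  have x: "dist w x < R" using assms by simp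
  have "0 < s * p" using \<open>0 < s\<close> \<open>1 \<le> p\<close> by simp
  then have "0 < Q" using \<open>s * p < Q\<close> by linarith
  have "1 < b" using \<open>s * p < Q\<close> \<open>1 \<le> p\<close> by (simp add: b field_simps)
  have "0 \<le> T" using cD_ge_1 by (simp add: T)
  \<comment> \<open>By \<open>lower\<close> at the ratio 1/2^(n+1), the mean of H^p exceeds the one
    over \<open>ball w (4 * R)\<close> by at most the factor 2^Q * 2^(Qn) / cQ. Its p-th root is
    \<open>K\<close> times 2^(nQ/p).\<close>
  have mean: "mean_nn_integral M (ball x (r n)) (\<lambda>z. epowr (H z) p) \<le> ennreal ((K * (2 powr (Q / p)) ^ n * j) powr p)" for n
  proof -
    define a where "a = cQ * (r n / (4 * R)) powr Q"
    have "r n / (4 * R) = 1 / (2 * 2 ^ n)" using \<open>0 < R\<close> by (simp add: r_def)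
    moreover have "((2 ^ n) powr Q :: real) = (2 powr Q) ^ n"
      by (induction n) (auto simp: powr_mult)
    ultimately have a_eq: "a = cQ / (2 powr Q * (2 powr Q) ^ n)"
      unfolding a_def by (simp only: powr_divide powr_mult) simp
    then have a: "0 < a" using \<open>0 < cQ\<close> by simp
    have "mean_nn_integral M (ball x (r n)) (\<lambda>z. epowr (H z) p)
        \<le> ennreal (1 / a) * mean_nn_integral M (ball w (4 * R)) (\<lambda>z. epowr (H z) p)"
    proof (rule mean_ball_subset)
      show "ball x (r n) \<subseteq> ball w (4 * R)"
      proof
        fix v assume "v \<in> ball x (r n)"
        then show "v \<in> ball w (4 * R)" using x r[of n] dist_triangle[of w v x] by simp
      qed
      have "a \<le> measure M (ball x (r n)) / measure M (ball w (4 * R))"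
        unfolding a_def using r[of n] \<open>0 < R\<close> by (intro lower) auto
      then show "measure M (ball w (4 * R)) \<le> 1 / a * measure M (ball x (r n))"
        using a measure_ball_pos[of "4 * R" w] \<open>0 < R\<close> by (simp add: field_simps)
    qed (use r[of n] \<open>0 < R\<close> in auto)
    also have "\<dots> \<le> ennreal (1 / a) * ennreal (j powr p)"
      by (intro mult_left_mono j) auto
    also have "\<dots> = ennreal ((K * (2 powr (Q / p)) ^ n * j) powr p)"
    proof -
      have "((2 powr (Q / p)) ^ n) powr p = (2 powr Q) ^ n"
        using \<open>1 \<le> p\<close> by (simp add: powr_powr powr_power)
      moreover have "K powr p = 2 powr Q / cQ"
        using \<open>1 \<le> p\<close> \<open>0 < cQ\<close> by (simp add: K_def powr_powr)
      ultimately have "1 / a * j powr p = (K * (2 powr (Q / p)) ^ n * j) powr p"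
        by (simp add: a_eq powr_mult)
      then show ?thesis using a by (simp flip: ennreal_mult)
    qed
    finally show ?thesis .
  qed
  have m_pos: "0 < K * (2 powr (Q / p)) ^ n * j" for n using K \<open>0 < j\<close> by simp
  show ?thesis unfolding r_def[symmetric]
  proof (induction n)
    case 0
    have "mean_nn_integral M (ball x (r 0)) (\<lambda>v. ennreal \<bar>u v\<bar>)
      \<le> mean_nn_integral M (ball w R) (\<lambda>v. ennreal \<bar>u v\<bar>) + ennreal (2 * cD ^ 3 * (4 * R) powr s * (K * (2 powr (Q / p)) ^ 0 * j))"
    proof (rule mean_le_mean_plus[OF u H _ r(1) _ \<open>1 \<le> p\<close> m_pos _ _ _ _ mean])
      fix z assume "z \<in> ball x (r 0)"
      then have z: "dist w z < 3 * R" using x dist_triangle[of w z x] by (simp add: r_def)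
      show "ball w R \<subseteq> ball z (4 * R)"
      proof
        fix v assume "v \<in> ball w R"
        then show "v \<in> ball z (4 * R)" using z dist_triangle[of z v w] by (simp add: dist_commute)
      qed
      \<comment> \<open>Now z is only known to lie within 3R of w, so \<open>ball z (4 * R)\<close>
        needs the ball of radius 8R about w, hence \<open>cD ^ 3\<close>.\<close>
      show "measure M (ball z (4 * R)) \<le> cD ^ 3 * measure M (ball w R)"
      proof (rule measure_le_doubled[OF \<open>0 < R\<close>], rule)
        fix v assume "v \<in> ball z (4 * R)"
        then show "v \<in> ball w (2 ^ 3 * R)" using z \<open>0 < R\<close> dist_triangle[of w v z] by simp
      qed
      show "mean_osc M u (4 * R) z \<le> ennreal ((4 * R) powr s) * H z"
        using z \<open>0 < R\<close> by (intro osc) auto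
    qed (use \<open>0 < R\<close> cD_ge_1 in auto)
    also have "\<dots> \<le> ennreal (A * R powr s * j) + ennreal (T * R powr s * j)"
    proof (intro add_mono A ennreal_leI)
      have "1 \<le> 2 powr (Q / p)" 
        using \<open>0 < Q\<close> \<open>1 \<le> p\<close> by (intro ge_one_powr_ge_zero) auto
      then have "2 * cD ^ 3 * 4 powr s * K * R powr s * j * 1 \<le> 2 * cD ^ 3 * 4 powr s * K * R powr s * j * 2 powr (Q / p)"
        using cD_ge_1 K \<open>0 < j\<close> by (intro mult_left_mono) auto
      then show "2 * cD ^ 3 * (4 * R) powr s * (K * (2 powr (Q / p)) ^ 0 * j) \<le> T * R powr s * j"
        by (simp add: T K_def powr_mult mult_ac)
    qed
    also have "\<dots> = ennreal ((A + T) * R powr s * j)"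
      using \<open>0 \<le> A\<close> \<open>0 \<le> T\<close> \<open>0 < j\<close> by (simp add: distrib_right flip: ennreal_plus)
    also have "\<dots> \<le> ennreal ((A + T + T / (b - 1)) * R powr s * j * b ^ 0)"
      using \<open>0 \<le> T\<close> \<open>1 < b\<close> \<open>0 < j\<close> by (auto intro!: ennreal_leI mult_right_mono)
    finally show ?case .
  next
    case (Suc n)
    have "mean_nn_integral M (ball x (r (Suc n))) (\<lambda>v. ennreal \<bar>u v\<bar>)
      \<le> mean_nn_integral M (ball x (r n)) (\<lambda>v. ennreal \<bar>u v\<bar>) +
         ennreal (2 * cD ^ 2 * (2 * r n) powr s * (K * (2 powr (Q / p)) ^ Suc n * j))"
    proof (rule mean_le_mean_plus[OF u H r(1) r(1) _ \<open>1 \<le> p\<close> m_pos _ _ _ _ mean])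
      have half: "r (Suc n) = r n / 2" by (simp add: r_def)
      fix z assume "z \<in> ball x (r (Suc n))"
      then have z: "dist x z < r n" using r(1)[of n] by (simp add: half)
      show "ball x (r n) \<subseteq> ball z (2 * r n)"
      proof
        fix v assume "v \<in> ball x (r n)"
        then show "v \<in> ball z (2 * r n)" using z dist_triangle[of z v x] by (simp add: dist_commute)
      qed
      show "measure M (ball z (2 * r n)) \<le> cD ^ 2 * measure M (ball x (r n))"
      proof (rule measure_le_doubled[OF r(1)], rule)
        fix v assume "v \<in> ball z (2 * r n)"
        then show "v \<in> ball x (2 ^ 2 * r n)" using z r(1)[of n] dist_triangle[of x v z] by simp
      qed
      show "mean_osc M u (2 * r n) z \<le> ennreal ((2 * r n) powr s) * H z"
        using z x r[of n] dist_triangle[of w z x] by (intro osc) auto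
    qed (use r[of n] cD_ge_1 in auto)
    also have "\<dots> \<le> ennreal ((A + T + T / (b - 1)) * R powr s * j * b ^ n) + ennreal (T * R powr s * j * b ^ n)"
    proof (intro add_mono Suc ennreal_leI)
      \<comment> \<open>The radius contributes 2^(-sn) and the p-th root of the mean 2^(nQ/p);
        together they make b^n. \<open>T\<close> contains both \<open>cD ^ 3\<close> from the start
        and 2^(Q/p) from this step, so it covers either.\<close>
      have "((2 ^ n) powr s :: real) = (2 powr s) ^ n"
        by (induction n) (auto simp: powr_mult)
      then have "(2 * r n) powr s = 4 powr s * R powr s / (2 powr s) ^ n"
        by (simp add: r_def powr_divide powr_mult)
      moreover have "b ^ n = (2 powr (Q / p)) ^ n / (2 powr s) ^ n"
        by (simp add: b powr_diff power_divide)
      ultimately have "2 * cD ^ 2 * (2 * r n) powr s * (K * (2 powr (Q / p)) ^ Suc n * j)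
          = 2 * 4 powr s * K * 2 powr (Q / p) * R powr s * j * b ^ n * cD ^ 2"
        by simp
      also have "\<dots> \<le> 2 * 4 powr s * K * 2 powr (Q / p) * R powr s * j * b ^ n * cD ^ 3"
        using cD_ge_1 K \<open>0 < j\<close> \<open>1 < b\<close> by (intro mult_left_mono power_increasing) auto
      finally show "2 * cD ^ 2 * (2 * r n) powr s * (K * (2 powr (Q / p)) ^ Suc n * j) \<le> T * R powr s * j * b ^ n"
        by (simp add: T K_def mult_ac)
    qed
    also have "\<dots> = ennreal ((A + T + T / (b - 1) + T) * (R powr s * j * b ^ n))"
      using \<open>0 \<le> T\<close> \<open>1 < b\<close> \<open>0 \<le> A\<close> \<open>0 < j\<close> by (simp add: algebra_simps flip: ennreal_plus)
    also have "\<dots> \<le> ennreal ((A + T + T / (b - 1)) * b * (R powr s * j * b ^ n))"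
    proof (intro ennreal_leI mult_right_mono)
      \<comment> \<open>\<open>T / (b - 1)\<close> solves x + T = x * b, so the growth from b^n to
        b^(n+1) absorbs the cost of one more step.\<close>
      have "T / (b - 1) * b = T / (b - 1) + T" using \<open>1 < b\<close> by (simp add: field_simps)
      moreover have "A + T \<le> (A + T) * b"
        using \<open>0 \<le> A\<close> \<open>0 \<le> T\<close> \<open>1 < b\<close> by (simp add: mult_le_cancel_left1)
      ultimately show "A + T + T / (b - 1) + T \<le> (A + T + T / (b - 1)) * b"
        by (simp add: distrib_right)
    qed (use \<open>0 < j\<close> \<open>1 < b\<close> in auto)
    finally show ?case by (simp add: mult_ac)
  qed
qed

text \<open>The radius \<open>2R/2\<^sup>n\<close> with \<open>2\<^sup>n \<approx> (h/j)\<^sup>p\<^sup>/\<^sup>Q\<close> balances the two terms of the sum.\<close>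

lemma abs_le_of_small_balls:
  assumes u: "continuous_on UNIV u"
    and "0 < R" "0 < j" "0 \<le> K" "0 < s" "1 \<le> p" "s * p < Q" "0 \<le> h"
    and osc: "\<And>r. 0 < r \<Longrightarrow> r \<le> 2 * R \<Longrightarrow> mean_osc M u r x \<le> ennreal (r powr s) * ennreal h"
    and mean: "\<And>n::nat. mean_nn_integral M (ball x (2 * R / 2 ^ n)) (\<lambda>v. ennreal \<bar>u v\<bar>)
      \<le> ennreal (K * R powr s * j * (2 powr (Q / p - s)) ^ n)"
  shows "\<bar>u x\<bar> \<le> (K + 4 powr s) * R powr s * j * (1 + (h / j) powr (1 - s * p / Q))"
proof -
  let ?b = "2 powr (Q / p - s)"
  have "0 < s * p" using \<open>0 < s\<close> \<open>1 \<le> p\<close> by simp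
  then have "0 < Q" using \<open>s * p < Q\<close> by linarith
  have bound: "\<bar>u x\<bar> \<le> K * R powr s * j * ?b ^ n + (2 * R / 2 ^ n) powr s * h" for n :: nat
  proof -
    let ?r = "2 * R / 2 ^ n"
    have r: "0 < ?r" "?r \<le> 2 * R" using \<open>0 < R\<close> by (auto simp: divide_le_eq mult_le_cancel_left1)
    have "ennreal \<bar>u x\<bar> \<le> mean_nn_integral M (ball x ?r) (\<lambda>v. ennreal \<bar>u v\<bar>) + ennreal 1 * mean_osc M u ?r x"
      by (rule abs_le_mean_plus_mean_osc[OF u r(1) r(1)]) auto
    also have "\<dots> \<le> ennreal (K * R powr s * j * ?b ^ n) + ennreal 1 * (ennreal (?r powr s) * ennreal h)"
      using osc[OF r] mean[of n] by (intro add_mono mult_left_mono) auto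
    also have "\<dots> = ennreal (K * R powr s * j * ?b ^ n + ?r powr s * h)"
      using \<open>0 \<le> K\<close> \<open>0 < j\<close> \<open>0 \<le> h\<close> by (simp flip: ennreal_mult ennreal_plus)
    finally show ?thesis
      using \<open>0 \<le> K\<close> \<open>0 < j\<close> \<open>0 \<le> h\<close> by (subst (asm) ennreal_le_iff) auto
  qed
  define y where "y = h / j"
  have h: "h = y * j" "0 \<le> y" using \<open>0 < j\<close> \<open>0 \<le> h\<close> by (auto simp: y_def)
  have "\<bar>u x\<bar> \<le> R powr s * j * (K + 4 powr s) * (1 + y powr (1 - s * p / Q))"
  \<comment> \<open>For h <= j the balancing n would not be positive, and n = 0 serves.\<close>
  proof (cases "y \<le> 1")
    case True
    have "\<bar>u x\<bar> \<le> R powr s * j * (K + 2 powr s * y)"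
      using bound[of 0] by (simp add: h powr_mult algebra_simps)
    also have "\<dots> \<le> R powr s * j * (K + 4 powr s)"
    proof (intro mult_left_mono add_left_mono)
      have "2 powr s * y \<le> 4 powr s * 1"
        using True h \<open>0 < s\<close> by (intro mult_mono powr_mono2) auto
      then show "2 powr s * y \<le> 4 powr s" by simp
    qed (use \<open>0 < j\<close> in auto)
    also have "\<dots> \<le> R powr s * j * (K + 4 powr s) * (1 + y powr (1 - s * p / Q))"
      using \<open>0 < j\<close> \<open>0 \<le> K\<close>
        mult_left_mono[of 1 "1 + y powr (1 - s * p / Q)" "R powr s * j * (K + 4 powr s)"] by simp
    finally show ?thesis .
  next
    case False
    then have "1 \<le> y powr (p / Q)"
      using \<open>0 < Q\<close> \<open>1 \<le> p\<close> by (intro ge_one_powr_ge_zero) auto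
    then obtain n where n: "2 ^ n \<le> y powr (p / Q)" "y powr (p / Q) < 2 * 2 ^ n"
      by (rule exists_dyadic_bracket)
    have "?b ^ n = (2 ^ n) powr (Q / p - s)"
      by (simp add: powr_power powr_realpow[symmetric] powr_powr mult.commute)
    also have "\<dots> \<le> (y powr (p / Q)) powr (Q / p - s)"
      using n \<open>s * p < Q\<close> \<open>1 \<le> p\<close> by (intro powr_mono2) (auto simp: field_simps)
    also have "\<dots> = y powr (1 - s * p / Q)"
    proof -
      have "p / Q * (Q / p - s) = 1 - s * p / Q"
        using \<open>0 < Q\<close> \<open>1 \<le> p\<close> by (simp add: field_simps)
      then show ?thesis by (simp add: powr_powr)
    qed
    finally have 1: "?b ^ n \<le> y powr (1 - s * p / Q)" .
    \<comment> \<open>Rounding n down makes the radius at most twice the balancing one; this turns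
      2^s into 4^s.\<close>
    have "(2 / 2 ^ n) powr s \<le> (4 / y powr (p / Q)) powr s"
      using n False \<open>0 < s\<close> by (intro powr_mono2) (auto simp: field_simps)
    also have "\<dots> = 4 powr s / y powr (s * p / Q)"
      by (simp add: powr_divide powr_powr mult.commute)
    finally have "(2 / 2 ^ n) powr s * y \<le> 4 powr s / y powr (s * p / Q) * y"
      using h by (intro mult_right_mono) auto
    also have "\<dots> = 4 powr s * y powr (1 - s * p / Q)"
      using False by (simp add: powr_diff)
    finally have 2: "(2 / 2 ^ n) powr s * y \<le> 4 powr s * y powr (1 - s * p / Q)" .
    have "(2 * R / 2 ^ n) powr s = R powr s * (2 / 2 ^ n) powr s"
      by (simp add: powr_mult[symmetric] mult.commute)
    then have "\<bar>u x\<bar> \<le> R powr s * j * (K * ?b ^ n + (2 / 2 ^ n) powr s * y)"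
      using bound[of n] by (simp add: h algebra_simps)
    also have "\<dots> \<le> R powr s * j * (K * y powr (1 - s * p / Q) + 4 powr s * y powr (1 - s * p / Q))"
      using 1 2 \<open>0 \<le> K\<close> \<open>0 < j\<close> by (intro mult_left_mono add_mono) auto
    also have "\<dots> \<le> R powr s * j * (K + 4 powr s) * (1 + y powr (1 - s * p / Q))"
      using \<open>0 \<le> K\<close> \<open>0 < j\<close> by (simp add: algebra_simps)
    finally show ?thesis .
  qed
  then show ?thesis by (simp add: y_def mult_ac)
qed

section \<open>From pointwise bounds to the L^q mean\<close>

text \<open>Because \<alpha> q <= p, y^(\<alpha> q) <= 1 + y^p for y = H/j. Hence |u|^q <= (2B)^q (2
  + (H/j)^p), and the mean of (H/j)^p over \<open>ball w R\<close> is at most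
  \<open>cD ^ 2\<close>.\<close>

lemma mean_powr_le_of_pointwise:
  fixes u :: "'a \<Rightarrow> real"
  assumes H [measurable]: "H \<in> borel_measurable M" and "0 < R" "0 < j" "0 < B" "1 \<le> q" "1 \<le> p"
    and \<alpha>: "0 < \<alpha>" "\<alpha> * q \<le> p"
    and j: "mean_nn_integral M (ball w (4 * R)) (\<lambda>z. epowr (H z) p) \<le> ennreal (j powr p)"
    and pw: "\<And>x h. x \<in> ball w R \<Longrightarrow> 0 \<le> h \<Longrightarrow> H x = ennreal h \<Longrightarrow> \<bar>u x\<bar> \<le> B * (1 + (h / j) powr \<alpha>)"
  shows "epowr (mean_nn_integral M (ball w R) (\<lambda>x. ennreal (\<bar>u x\<bar> powr q))) (p / q)
    \<le> ennreal ((2 * B) powr p * (2 + cD ^ 2) powr (p / q))"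
proof -
  let ?c = "(2 * B) powr q"
  have "mean_nn_integral M (ball w R) (\<lambda>x. ennreal (\<bar>u x\<bar> powr q))
      \<le> mean_nn_integral M (ball w R) (\<lambda>x. ennreal ?c * (2 + ennreal (1 / j powr p) * epowr (H x) p))"
  proof (intro mean_nn_integral_mono)
    fix x assume x: "x \<in> ball w R"
    show "ennreal (\<bar>u x\<bar> powr q) \<le> ennreal ?c * (2 + ennreal (1 / j powr p) * epowr (H x) p)"
    \<comment> \<open>Where \<open>H\<close> is infinite so is the right side; the pointwise bound
      is therefore asked for finite values only.\<close>
    proof (cases "H x")
      case (real h)
      define y where "y = h / j"
      have y: "0 \<le> y" using real \<open>0 < j\<close> by (simp add: y_def)
      have y_le: "y powr (\<alpha> * q) \<le> 1 + y powr p"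
      proof (cases "y \<le> 1")
        case True
        then have "y powr (\<alpha> * q) \<le> 1" using y \<alpha> \<open>1 \<le> q\<close> by (intro powr_le1) auto
        then show ?thesis by (simp add: add_increasing2)
      next
        case False
        then have "y powr (\<alpha> * q) \<le> y powr p" using \<alpha> by (intro powr_mono) auto
        then show ?thesis by simp
      qed
      have "(1 + y powr \<alpha>) powr q \<le> (2 * max 1 (y powr \<alpha>)) powr q"
        using \<open>1 \<le> q\<close> by (intro powr_mono2) auto
      also have "\<dots> \<le> 2 powr q * (1 + y powr (\<alpha> * q))"
        by (auto simp: max_def powr_mult powr_powr)
      also have "\<dots> \<le> 2 powr q * (2 + y powr p)"
        using y_le by (intro mult_left_mono) auto
      finally have "B powr q * (1 + y powr \<alpha>) powr q \<le> B powr q * (2 powr q * (2 + y powr p))"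
        by (intro mult_left_mono) auto
      moreover have "\<bar>u x\<bar> powr q \<le> (B * (1 + y powr \<alpha>)) powr q"
        using pw[OF x] real \<open>1 \<le> q\<close> unfolding y_def by (intro powr_mono2) auto
      ultimately have "\<bar>u x\<bar> powr q \<le> ?c * (2 + y powr p)"
        by (simp add: powr_mult mult_ac)
      then have "\<bar>u x\<bar> powr q \<le> ?c * (2 + 1 / j powr p * h powr p)"
        by (simp add: y_def powr_divide)
      then have "ennreal (\<bar>u x\<bar> powr q) \<le> ennreal (?c * (2 + 1 / j powr p * h powr p))"
        by (rule ennreal_leI)
      also have "\<dots> = ennreal ?c * ennreal (2 + 1 / j powr p * h powr p)"
        by (rule ennreal_mult') simp
      also have "ennreal (2 + 1 / j powr p * h powr p) = 2 + ennreal (1 / j powr p) * ennreal (h powr p)"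
        by (subst ennreal_plus) (simp, simp, subst ennreal_mult, simp_all)
      finally show ?thesis using real by simp
    qed (use \<open>0 < B\<close> \<open>0 < j\<close> in \<open>simp add: ennreal_mult_eq_top_iff\<close>)
  qed
  also have "\<dots> = ennreal ?c * (2 + ennreal (1 / j powr p) * mean_nn_integral M (ball w R) (\<lambda>x. epowr (H x) p))"
    using \<open>0 < R\<close> emeasure_ball_neq
    by (simp add: mean_nn_integral_cmult mean_nn_integral_add mean_nn_integral_const)
  also have "\<dots> \<le> ennreal ?c * (2 + ennreal (1 / j powr p) * (ennreal (cD ^ 2) * ennreal (j powr p)))"
  proof (intro mult_left_mono add_left_mono)
    have "mean_nn_integral M (ball w R) (\<lambda>x. epowr (H x) p)
        \<le> ennreal (cD ^ 2) * mean_nn_integral M (ball w (4 * R)) (\<lambda>x. epowr (H x) p)"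
      using \<open>0 < R\<close> measure_double_pow[of R w 2] by (intro mean_ball_subset) auto
    also have "\<dots> \<le> ennreal (cD ^ 2) * ennreal (j powr p)"
      by (intro mult_left_mono j) auto
    finally show "mean_nn_integral M (ball w R) (\<lambda>x. epowr (H x) p) \<le> \<dots>" .
  qed auto
  also have "\<dots> = ennreal (?c * (2 + cD ^ 2))"
  proof -
    have "ennreal (1 / j powr p) * (ennreal (cD ^ 2) * ennreal (j powr p)) = ennreal (cD ^ 2)"
      using \<open>0 < j\<close> by (simp flip: ennreal_mult)
    then show ?thesis by (simp add: ennreal_mult)
  qed
  finally have "epowr (mean_nn_integral M (ball w R) (\<lambda>x. ennreal (\<bar>u x\<bar> powr q))) (p / q)
      \<le> epowr (ennreal (?c * (2 + cD ^ 2))) (p / q)"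
    using \<open>1 \<le> p\<close> \<open>1 \<le> q\<close> by (intro epowr_mono) auto
  also have "\<dots> = ennreal ((2 * B) powr p * (2 + cD ^ 2) powr (p / q))"
    using \<open>1 \<le> q\<close> by (simp add: powr_mult powr_powr)
  finally show ?thesis .
qed

text \<open>\<open>H\<close> stays abstract since it will be the measurable substitute for the
  gradient, and \<open>j\<close> is any positive bound since the exact mean may be 0 and
  \<open>j\<close> is a divisor. \<open>K\<close> has to be chosen before all of them.\<close>

lemma mean_powr_le_gradient:
  assumes complete: "complete (UNIV :: 'a set)" and "closed E"
    and "0 < cQ" and lower: "\<And>x R r y. y \<in> ball x R \<Longrightarrow> 0 < r \<Longrightarrow> r < R \<Longrightarrow>
      cQ * (r / R) powr Q \<le> measure M (ball y r) / measure M (ball x R)"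
    and qp: "1 \<le> q" "1 \<le> p" "0 < s" "q \<le> p \<or> (s * p < Q \<and> q \<le> Q * p / (Q - s * p))"
    and "0 < c" "Q' < s * p"
    and codim: "\<And>x r \<rho>. x \<in> E \<Longrightarrow> 0 < r \<Longrightarrow> r < \<rho> \<Longrightarrow> ennreal \<rho> < ediam E \<Longrightarrow>
      c * (r / \<rho>) powr Q' \<le> measure M (nbhd E r \<inter> ball x \<rho>) / measure M (ball x \<rho>)"
  obtains K where "0 < K"
    and "\<And>u w R H j. continuous_on UNIV u \<Longrightarrow> (\<And>x. x \<in> E \<Longrightarrow> u x = 0) \<Longrightarrow> w \<in> E \<Longrightarrow>
      0 < R \<Longrightarrow> ennreal R < ediam E \<Longrightarrow> 0 < j \<Longrightarrow> H \<in> borel_measurable M \<Longrightarrow>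
      (\<And>z r. z \<in> ball w (4 * R) \<Longrightarrow> 0 < r \<Longrightarrow> r \<le> 4 * R \<Longrightarrow> mean_osc M u r z \<le> ennreal (r powr s) * H z) \<Longrightarrow>
      mean_nn_integral M (ball w (4 * R)) (\<lambda>z. epowr (H z) p) \<le> ennreal (j powr p) \<Longrightarrow>
      epowr (mean_nn_integral M (ball w R) (\<lambda>x. ennreal (\<bar>u x\<bar> powr q))) (p / q)
        \<le> ennreal (K * R powr (s * p) * j powr p)"
proof -
  obtain m where m: "3 \<le> m"
    "(1 / 2 ^ m) powr s * (2 * cD ^ 4 / (c * (4 / 2 ^ m) powr Q')) powr (1 / p) \<le> 1 / 2"
    by (rule exists_contraction_scale[OF \<open>0 < c\<close> \<open>Q' < s * p\<close> qp(2)])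
  define A where "A = 4 * cD ^ (m + 2) * 2 powr s * cD ^ 2"
  have "0 \<le> A" using cD_ge_1 by (simp add: A_def)
  define b where "b = 2 powr (Q / p - s)"
  define T where "T = 2 * cD ^ 3 * 4 powr s * (2 powr Q / cQ) powr (1 / p) * 2 powr (Q / p)"
  have "0 \<le> T" using cD_ge_1 by (simp add: T_def)
  define \<alpha> where "\<alpha> = (if q \<le> p then 1 else 1 - s * p / Q)"
  define B where "B = (if q \<le> p then A + cD ^ 2 * 2 powr s else A + T + T / (b - 1) + 4 powr s)"
  have sp: "0 < s * p" using qp by simp
  have case2: "s * p < Q" "q \<le> Q * p / (Q - s * p)" "0 < Q" if "\<not> q \<le> p"
    using qp(4) that sp by auto
  have b_gt: "1 < b" if "\<not> q \<le> p"
    using case2[OF that] qp by (simp add: b_def field_simps)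
  have "0 < B" using b_gt \<open>0 \<le> A\<close> \<open>0 \<le> T\<close> cD_ge_1
    by (auto simp: B_def intro!: add_nonneg_pos add_nonneg_nonneg mult_pos_pos)
  \<comment> \<open>If q > p, the assumption q <= Q p / (Q - s p) is just (1 - s p / Q) q <=
    p.\<close>
  have \<alpha>: "0 < \<alpha>" "\<alpha> * q \<le> p"
    using case2 by (auto simp: \<alpha>_def field_simps)
  show thesis
  proof (rule that)
    show "0 < (2 * B) powr p * (2 + cD ^ 2) powr (p / q)"
    proof -
      have "0 < 2 + cD ^ 2" using zero_le_power2[of cD] by linarith
      then show ?thesis using \<open>0 < B\<close> by simp
    qed
  next
    fix u :: "'a \<Rightarrow> real" and w R H j
    assume u: "continuous_on UNIV u" "\<And>x. x \<in> E \<Longrightarrow> u x = 0" and w: "w \<in> E"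
      and R: "0 < R" "ennreal R < ediam E" and "0 < j" and H: "H \<in> borel_measurable M"
      and osc: "\<And>z r. z \<in> ball w (4 * R) \<Longrightarrow> 0 < r \<Longrightarrow> r \<le> 4 * R \<Longrightarrow> mean_osc M u r z \<le> ennreal (r powr s) * H z"
      and j: "mean_nn_integral M (ball w (4 * R)) (\<lambda>z. epowr (H z) p) \<le> ennreal (j powr p)"
    have avg: "mean_nn_integral M (ball w R) (\<lambda>v. ennreal \<bar>u v\<bar>) \<le> ennreal (A * R powr s * j)"
    proof -
      \<comment> \<open>Shrinking the ball from 4R to R multiplies the bound for the mean by
        \<open>cD ^ 2\<close>, which is at most its p-th power; so \<open>j\<close> becomes
        \<open>cD ^ 2 * j\<close>. This is the last factor of \<open>A\<close>.\<close>
      have jw: "mean_nn_integral M (ball w R) (\<lambda>z. epowr (H z) p) \<le> ennreal ((cD ^ 2 * j) powr p)"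
      proof -
        have "mean_nn_integral M (ball w R) (\<lambda>z. epowr (H z) p)
            \<le> ennreal (cD ^ 2) * mean_nn_integral M (ball w (4 * R)) (\<lambda>z. epowr (H z) p)"
          using R measure_double_pow[of R w 2] by (intro mean_ball_subset) auto
        also have "\<dots> \<le> ennreal (cD ^ 2) * ennreal (j powr p)"
          by (intro mult_left_mono j) auto
        also have "\<dots> \<le> ennreal ((cD ^ 2) powr p * j powr p)"
        proof -
          have "1 \<le> cD ^ 2" using cD_ge_1 by (simp add: one_le_power)
          then have "(cD ^ 2) powr 1 \<le> (cD ^ 2) powr p" using qp by (intro powr_mono) auto
          then show ?thesis
            using cD_ge_1 by (auto intro!: ennreal_leI mult_right_mono simp flip: ennreal_mult)
        qed
        finally show ?thesis by (simp add: powr_mult)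
      qed
      have "mean_nn_integral M (ball w R) (\<lambda>v. ennreal \<bar>u v\<bar>)
          \<le> ennreal (4 * cD ^ (m + 2) * 2 powr s * R powr s * (cD ^ 2 * j))"
      proof (rule mean_le_of_vanishing[OF complete \<open>closed E\<close> u w R(1) m(1) \<open>0 < c\<close> \<open>0 < s\<close> qp(2) _ _ H _ jw refl m(2)])
        show "0 < cD ^ 2 * j" using cD_ge_1 \<open>0 < j\<close> by simp
        show "c * (r / \<rho>) powr Q' \<le> measure M (nbhd E r \<inter> ball x \<rho>) / measure M (ball x \<rho>)"
          if "x \<in> E" "0 < r" "r < \<rho>" "\<rho> \<le> R" for x r \<rho>
          using that R by (intro codim) (auto intro: le_less_trans[OF ennreal_leI])
        show "mean_osc M u r z \<le> ennreal (r powr s) * H z"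
          if "z \<in> ball w R" "0 < r" "r \<le> 2 * R" for z r
          using that by (intro osc) auto
      qed
      then show ?thesis by (simp add: A_def mult_ac)
    qed
    have "\<bar>u x\<bar> \<le> B * R powr s * j * (1 + (h / j) powr \<alpha>)"
      if x: "x \<in> ball w R" and h: "0 \<le> h" "H x = ennreal h" for x h
    proof (cases "q \<le> p")
      case True
      have "mean_osc M u (2 * R) x \<le> ennreal ((2 * R) powr s) * ennreal h"
        unfolding h(2)[symmetric] using x R by (intro osc) auto
      then have "\<bar>u x\<bar> \<le> (A + cD ^ 2 * 2 powr s) * R powr s * j * (1 + h / j)"
        by (rule abs_le_of_mean[OF u(1) R(1) \<open>0 < j\<close> \<open>0 \<le> A\<close> x _ h(1) avg])
      then show ?thesis using True h(1) \<open>0 < j\<close> by (simp add: B_def \<alpha>_def)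
    next
      case False
      have mean: "mean_nn_integral M (ball x (2 * R / 2 ^ n)) (\<lambda>v. ennreal \<bar>u v\<bar>)
          \<le> ennreal ((A + T + T / (b - 1)) * R powr s * j * b ^ n)" for n
      proof (rule mean_small_ball_le[OF u(1) H R(1) \<open>0 < j\<close> \<open>0 \<le> A\<close> x qp(3,2) \<open>0 < cQ\<close> case2(1)[OF False]
              _ j avg _ b_def T_def])
        show "mean_osc M u r z \<le> ennreal (r powr s) * H z"
          if "z \<in> ball w (4 * R)" "0 < r" "r \<le> 4 * R" for z r using that by (rule osc)
        show "cQ * (r / (4 * R)) powr Q \<le> measure M (ball x r) / measure M (ball w (4 * R))"
          if "0 < r" "r < 4 * R" for r using that x R by (intro lower) auto
      qed
      have "\<bar>u x\<bar> \<le> (A + T + T / (b - 1) + 4 powr s) * R powr s * j * (1 + (h / j) powr (1 - s * p / Q))"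
      proof (rule abs_le_of_small_balls[OF u(1) R(1) \<open>0 < j\<close> _ qp(3,2) case2(1)[OF False] h(1)])
        show "0 \<le> A + T + T / (b - 1)"
          using \<open>0 \<le> A\<close> \<open>0 \<le> T\<close> b_gt[OF False] by simp
        show "mean_osc M u r x \<le> ennreal (r powr s) * ennreal h" if "0 < r" "r \<le> 2 * R" for r
          unfolding h(2)[symmetric] using x that by (intro osc) auto
        show "mean_nn_integral M (ball x (2 * R / 2 ^ n)) (\<lambda>v. ennreal \<bar>u v\<bar>)
            \<le> ennreal ((A + T + T / (b - 1)) * R powr s * j * (2 powr (Q / p - s)) ^ n)" for n :: nat
          using mean[of n] by (simp only: b_def)
      qed
      then show ?thesis using False by (simp add: B_def \<alpha>_def b_def)
    qed
    then have "epowr (mean_nn_integral M (ball w R) (\<lambda>x. ennreal (\<bar>u x\<bar> powr q))) (p / q)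
        \<le> ennreal ((2 * (B * R powr s * j)) powr p * (2 + cD ^ 2) powr (p / q))"
      using \<open>0 < B\<close> R(1) \<open>0 < j\<close> by (intro mean_powr_le_of_pointwise[OF H R(1) \<open>0 < j\<close> _ qp(1,2) \<alpha> j]) auto
    also have "(2 * (B * R powr s * j)) powr p * (2 + cD ^ 2) powr (p / q)
        = (2 * B) powr p * (2 + cD ^ 2) powr (p / q) * R powr (s * p) * j powr p"
      by (simp add: powr_mult powr_powr mult_ac)
    finally show "epowr (mean_nn_integral M (ball w R) (\<lambda>x. ennreal (\<bar>u x\<bar> powr q))) (p / q)
        \<le> ennreal ((2 * B) powr p * (2 + cD ^ 2) powr (p / q) * R powr (s * p) * j powr p)" .
  qed
qed

end

section \<open>Return to the seminorm\<close>

theorem corollary4p8: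
  fixes M :: "'a::metric_space measure"
    and E :: "'a set"
    and Q cQ q p s t :: real
  assumes "metric_measure_space M"
    and "doubling M"
    and "complete (UNIV :: 'a set)"
    and "0 < Q" and "0 < cQ"
    and "\<forall>x R r. \<forall>y\<in>ball x R. 0 < r \<longrightarrow> r < R \<longrightarrow>
           measure M (ball y r) / measure M (ball x R) \<ge> cQ * (r / R) powr Q"
    and "1 \<le> q" and "1 \<le> p" and "0 < s" and "s < 1" and "1 \<le> t"
    and "(q \<le> p \<and> p \<le> t) \<or> (s * p < Q \<and> q \<le> Q * p / (Q - s * p) \<and> t = p)"
    and "reverse_doubling M"
    and "closed E"
    and "upper_assouad_codim M E < ereal (s * p)"
  shows "\<exists>C>0. \<exists>lam\<ge>1. \<forall>(u :: 'a \<Rightarrow> real) w R.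
    continuous_on UNIV u \<longrightarrow> (\<forall>x\<in>E. u x = 0) \<longrightarrow>
    w \<in> E \<longrightarrow> 0 < R \<longrightarrow> ennreal R < ediam E / 2 \<longrightarrow>
    epowr (mean_nn_integral M (ball w R) (\<lambda>x. ennreal (\<bar>u x\<bar> powr q))) (p / q)
      \<le> ennreal (C * R powr (s * p)) *
         mean_nn_integral M (ball w (lam * R)) (\<lambda>x.
           epowr (\<integral>\<^sup>+y\<in>ball w (lam * R).
                    ennreal (\<bar>u x - u y\<bar> powr t /
                      (dist x y powr (s * t) * measure M (ball x (dist x y)))) \<partial>M)
                 (p / t))"
proof -
  obtain cD where "1 \<le> cD" "\<And>x r. 0 < r \<Longrightarrow> measure M (ball x (2 * r)) \<le> cD * measure M (ball x r)"
    using assms(2) by (auto simp: doubling_def)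
  then interpret doubling_space M cD
    using assms(1) by (simp add: doubling_space_def doubling_space_axioms_def)
  obtain Q' c where Q': "Q' < s * p" "0 < c"
    and codim: "\<And>x r \<rho>. x \<in> E \<Longrightarrow> 0 < r \<Longrightarrow> r < \<rho> \<Longrightarrow> ennreal \<rho> < ediam E \<Longrightarrow>
      c * (r / \<rho>) powr Q' \<le> measure M (nbhd E r \<inter> ball x \<rho>) / measure M (ball x \<rho>)"
    using assms(15) unfolding upper_assouad_codim_def Inf_less_iff by fastforce
  have qp: "q \<le> p \<or> (s * p < Q \<and> q \<le> Q * p / (Q - s * p))" using assms(12) by blast
  have lower: "cQ * (r / R) powr Q \<le> measure M (ball y r) / measure M (ball x R)"
    if "y \<in> ball x R" "0 < r" "r < R" for x R r y
    using assms(6) that by blast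
  obtain K where "0 < K" and K: "\<And>u w R H j. continuous_on UNIV u \<Longrightarrow> (\<And>x. x \<in> E \<Longrightarrow> u x = 0) \<Longrightarrow> w \<in> E \<Longrightarrow>
      0 < R \<Longrightarrow> ennreal R < ediam E \<Longrightarrow> 0 < j \<Longrightarrow> H \<in> borel_measurable M \<Longrightarrow>
      (\<And>z r. z \<in> ball w (4 * R) \<Longrightarrow> 0 < r \<Longrightarrow> r \<le> 4 * R \<Longrightarrow> mean_osc M u r z \<le> ennreal (r powr s) * H z) \<Longrightarrow>
      mean_nn_integral M (ball w (4 * R)) (\<lambda>z. epowr (H z) p) \<le> ennreal (j powr p) \<Longrightarrow>
      epowr (mean_nn_integral M (ball w R) (\<lambda>x. ennreal (\<bar>u x\<bar> powr q))) (p / q)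
        \<le> ennreal (K * R powr (s * p) * j powr p)"
    using mean_powr_le_gradient[OF assms(3,14,5) lower assms(7,8,9) qp Q'(2,1) codim] by blast
  \<comment> \<open>\<open>cD * 2 powr s\<close> is the price of the dyadic supremum, and 2 the loss
    in Jensen's inequality for exponent t.\<close>
  define c1 where "c1 = (cD * 2 powr s * 2) powr p"
  have "0 < c1" using cD_ge_1 by (simp add: c1_def)
  show ?thesis
  \<comment> \<open>\<open>H\<close> is needed on \<open>ball w (4 * R)\<close> and sees radii up to
    4R, so its balls reach up to 8R from w. The factor \<open>cD\<close> in the constant pays for
    the mean over the larger ball.\<close>
  proof (rule exI[of _ "K * (c1 * cD)"], intro conjI exI[of _ "8::real"] allI impI)
    show "0 < K * (c1 * cD)" using \<open>0 < K\<close> \<open>0 < c1\<close> cD_ge_1 by simp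
    show "(1::real) \<le> 8" by simp
    fix u :: "'a \<Rightarrow> real" and w R
    assume u: "continuous_on UNIV u" "\<forall>x\<in>E. u x = 0" and "w \<in> E" "0 < R" "ennreal R < ediam E / 2"
    let ?g = "\<lambda>x. \<integral>\<^sup>+y\<in>ball w (8 * R).
                    ennreal (\<bar>u x - u y\<bar> powr t /
                      (dist x y powr (s * t) * measure M (ball x (dist x y)))) \<partial>M"
    let ?T = "mean_nn_integral M (ball w (8 * R)) (\<lambda>x. epowr (?g x) (p / t))"
    let ?L = "epowr (mean_nn_integral M (ball w R) (\<lambda>x. ennreal (\<bar>u x\<bar> powr q))) (p / q)"
    have "ediam E / 2 \<le> ediam E"
      by (rule divide_le_posI_ennreal) (auto simp: mult_2 mult_2_right)
    then have R: "ennreal R < ediam E" using \<open>ennreal R < ediam E / 2\<close> by simp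
    have "0 < 4 * R" "0 \<le> s" using \<open>0 < R\<close> \<open>0 < s\<close> by auto
    then obtain H where H [measurable]: "H \<in> borel_measurable M"
      and osc: "\<And>x r. 0 < r \<Longrightarrow> r \<le> 4 * R \<Longrightarrow> mean_osc M u r x \<le> ennreal (r powr s) * H x"
      and H_le: "\<And>x G. (\<And>r. 0 < r \<Longrightarrow> r \<le> 4 * R \<Longrightarrow> mean_osc M u r x \<le> ennreal (r powr s) * G)
           \<Longrightarrow> H x \<le> ennreal (cD * 2 powr s) * G"
      using fractional_sharp_function[OF u(1)] by metis
    \<comment> \<open>The constant stands next to \<open>H\<close>, since taking it out of the mean
      uses measurability, which is known for \<open>H\<close> but not for \<open>?g\<close>.\<close>
    have HG: "ennreal (1 / c1) * epowr (H x) p \<le> epowr (?g x) (p / t)" if x: "x \<in> ball w (4 * R)" for x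
    proof -
      have "H x \<le> ennreal (cD * 2 powr s) * (2 * epowr (?g x) (1 / t))"
      proof (rule H_le, rule mean_osc_le_seminorm[OF u(1) \<open>1 \<le> t\<close> \<open>0 < s\<close>])
        fix r assume "r \<le> 4 * R"
        then show "ball x r \<subseteq> ball w (8 * R)"
        proof safe
          fix v assume "v \<in> ball x r"
          then show "v \<in> ball w (8 * R)" using x \<open>r \<le> 4 * R\<close> dist_triangle[of w v x] by simp
        qed
      qed
      also have "\<dots> = ennreal (cD * 2 powr s * 2) * epowr (?g x) (1 / t)"
        using cD_ge_1 by (simp add: ennreal_mult' mult_ac)
      finally have "epowr (H x) p \<le> epowr (ennreal (cD * 2 powr s * 2) * epowr (?g x) (1 / t)) p"
        using \<open>1 \<le> p\<close> by (intro epowr_mono) auto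
      also have "\<dots> = ennreal c1 * epowr (?g x) (p / t)"
        using cD_ge_1 by (simp add: epowr_ennreal_mult epowr_epowr c1_def)
      finally have "ennreal (1 / c1) * epowr (H x) p \<le> ennreal (1 / c1) * (ennreal c1 * epowr (?g x) (p / t))"
        by (intro mult_left_mono) auto
      then show ?thesis
        using \<open>0 < c1\<close> by (simp add: mult.assoc[symmetric] flip: ennreal_mult)
    qed
    have H4: "mean_nn_integral M (ball w (4 * R)) (\<lambda>z. epowr (H z) p) \<le> ennreal (c1 * cD) * ?T"
    proof -
      have "mean_nn_integral M (ball w (4 * R)) (\<lambda>z. epowr (H z) p)
          = ennreal c1 * (ennreal (1 / c1) * mean_nn_integral M (ball w (4 * R)) (\<lambda>z. epowr (H z) p))"
        using \<open>0 < c1\<close> by (simp add: mult.assoc[symmetric] flip: ennreal_mult)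
      also have "\<dots> = ennreal c1 * mean_nn_integral M (ball w (4 * R)) (\<lambda>z. ennreal (1 / c1) * epowr (H z) p)"
        by (simp add: mean_nn_integral_cmult)
      also have "\<dots> \<le> ennreal c1 * mean_nn_integral M (ball w (4 * R)) (\<lambda>x. epowr (?g x) (p / t))"
        by (intro mult_left_mono mean_nn_integral_mono HG) auto
      also have "\<dots> \<le> ennreal c1 * (ennreal cD * ?T)"
        using \<open>0 < R\<close> measure_double[of "4 * R" w] by (intro mult_left_mono mean_ball_subset) auto
      finally show ?thesis using \<open>0 < c1\<close> cD_ge_1 by (simp add: ennreal_mult mult.assoc)
    qed
    show "?L \<le> ennreal (K * (c1 * cD) * R powr (s * p)) * ?T"
    proof (cases ?T)
      case (real \<tau>)
      define k where "k = K * R powr (s * p)"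
      have "0 < k" using \<open>0 < K\<close> \<open>0 < R\<close> by (simp add: k_def)
      have "?L \<le> ennreal (k * (c1 * cD) * \<tau>) + ennreal e" if "0 < e" for e
      proof -
        \<comment> \<open>The value of j^p: the summand e/k keeps it positive even for \<tau> = 0,
          and multiplication by \<open>k\<close> turns it into \<open>e\<close>.\<close>
        define y where "y = c1 * cD * \<tau> + e / k"
        have "0 < y" using that \<open>0 < k\<close> \<open>0 < c1\<close> cD_ge_1 real by (simp add: y_def add_nonneg_pos)
        then have jp: "(y powr (1 / p)) powr p = y" using \<open>1 \<le> p\<close> by (simp add: powr_powr)
        have "?L \<le> ennreal (K * R powr (s * p) * (y powr (1 / p)) powr p)"
        proof (rule K[OF u(1) _ \<open>w \<in> E\<close> \<open>0 < R\<close> R _ H osc])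
          have "ennreal (c1 * cD) * ?T \<le> ennreal y"
            unfolding real(2) using that \<open>0 < k\<close> \<open>0 < c1\<close> cD_ge_1 real(1)
            by (auto simp: y_def intro!: ennreal_leI simp flip: ennreal_mult)
          with H4 show "mean_nn_integral M (ball w (4 * R)) (\<lambda>z. epowr (H z) p)
              \<le> ennreal ((y powr (1 / p)) powr p)"
            unfolding jp by (rule order_trans)
        qed (use u \<open>0 < y\<close> in auto)
        also have "K * R powr (s * p) * (y powr (1 / p)) powr p = k * (c1 * cD) * \<tau> + e"
          unfolding jp k_def[symmetric] using \<open>0 < k\<close> by (simp add: y_def distrib_left mult.assoc)
        also have "ennreal \<dots> = ennreal (k * (c1 * cD) * \<tau>) + ennreal e"
          using that \<open>0 < k\<close> \<open>0 < c1\<close> cD_ge_1 real by (intro ennreal_plus) auto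
        finally show ?thesis .
      qed
      then have "?L \<le> ennreal (k * (c1 * cD) * \<tau>)" by (rule ennreal_le_epsilon)
      also have "\<dots> = ennreal (K * (c1 * cD) * R powr (s * p)) * ?T"
        unfolding real(2) using real(1)
        by (subst ennreal_mult''[symmetric]) (simp_all add: k_def mult_ac)
      finally show ?thesis .
    next
      case top
      have "0 < K * (c1 * cD) * R powr (s * p)"
        using \<open>0 < K\<close> \<open>0 < c1\<close> \<open>0 < R\<close> cD_ge_1 by simp
      then have "ennreal (K * (c1 * cD) * R powr (s * p)) \<noteq> 0"
        by (subst ennreal_eq_0_iff) linarith
      then show ?thesis unfolding top by (subst ennreal_top_mult_left) simp_all
    qed
  qed
qed

end
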